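(* Let $A(x,y,c)$ and $B(z,u,c)$ be quantifier-free formulas and suppose $\mathsf{EA}\vdash\forall x\exists y\, A(x,y,c)\leftrightarrow\exists z\forall u\, B(z,u,c)$. Then there is a Boolean combination $\psi(c)$ of $\Sigma^0_1$ formulas such that $\mathsf{EA}\vdash\exists z\forall u\, B(z,u,c)\leftrightarrow\psi(c)$.
   Context: $\mathsf{EA}$ (elementary recursive arithmetic) is the first-order theory whose language has a function symbol for each code of an elementary recursive function, with purely universal defining axioms and induction restricted to quantifier-free formulas. Provability of a formula with free variable $c$ means provability with $c$ free. *)

theory Defs
  imports Main
begin

text \<open>
  Kalmar codes of elementary recursive functions: the basic functions are closed under
  composition and under bounded sums and products.  The number in \<open>Comp n f gs\<close> is the arity of
  the composite (it is needed when \<open>gs\<close> is empty); the first argument of \<open>BSum f\<close> and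
  \<open>BProd f\<close> is the strict bound, i.e. \<open>BSum f (y, xs)\<close> is the sum of \<open>f (i, xs)\<close> over \<open>i < y\<close>.
\<close>

datatype code =
    Zero
  | Succ
  | Proj nat nat
  | Add
  | Mul
  | Monus
  | Comp nat code "code list"
  | BSum code
  | BProd code

inductive elem_code :: "nat \<Rightarrow> code \<Rightarrow> bool" where
  "elem_code 0 Zero"
| "elem_code 1 Succ"
| "i < n \<Longrightarrow> elem_code n (Proj n i)"
| "elem_code 2 Add"
| "elem_code 2 Mul"
| "elem_code 2 Monus"
| "elem_code (length gs) f \<Longrightarrow> (\<And>g. g \<in> set gs \<Longrightarrow> elem_code n g) \<Longrightarrow> elem_code n (Comp n f gs)"
| "elem_code (Suc n) f \<Longrightarrow> elem_code (Suc n) (BSum f)"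
| "elem_code (Suc n) f \<Longrightarrow> elem_code (Suc n) (BProd f)"

text \<open>
  First-order terms and formulas with equality over these function symbols.  Variables are
  de Bruijn indices: an index not captured by a quantifier is a free variable.
\<close>

datatype tm = Var nat | App code "tm list"

datatype fm = Fls | Eq tm tm | Imp fm fm | Forall fm

abbreviation Neg :: "fm \<Rightarrow> fm" where "Neg \<phi> \<equiv> Imp \<phi> Fls"
abbreviation Or :: "fm \<Rightarrow> fm \<Rightarrow> fm" where "Or \<phi> \<psi> \<equiv> Imp (Neg \<phi>) \<psi>"
abbreviation And :: "fm \<Rightarrow> fm \<Rightarrow> fm" where "And \<phi> \<psi> \<equiv> Neg (Imp \<phi> (Neg \<psi>))"
abbreviation Iff :: "fm \<Rightarrow> fm \<Rightarrow> fm" where "Iff \<phi> \<psi> \<equiv> And (Imp \<phi> \<psi>) (Imp \<psi> \<phi>)"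
abbreviation Exists :: "fm \<Rightarrow> fm" where "Exists \<phi> \<equiv> Neg (Forall (Neg \<phi>))"

fun wf_tm :: "tm \<Rightarrow> bool" where
  "wf_tm (Var i) = True"
| "wf_tm (App f ts) = (elem_code (length ts) f \<and> (\<forall>t\<in>set ts. wf_tm t))"

fun wf_fm :: "fm \<Rightarrow> bool" where
  "wf_fm Fls = True"
| "wf_fm (Eq s t) = (wf_tm s \<and> wf_tm t)"
| "wf_fm (Imp \<phi> \<psi>) = (wf_fm \<phi> \<and> wf_fm \<psi>)"
| "wf_fm (Forall \<phi>) = wf_fm \<phi>"

fun fv_tm :: "tm \<Rightarrow> nat set" where
  "fv_tm (Var i) = {i}"
| "fv_tm (App f ts) = (\<Union>t\<in>set ts. fv_tm t)"

fun fv :: "fm \<Rightarrow> nat set" where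
  "fv Fls = {}"
| "fv (Eq s t) = fv_tm s \<union> fv_tm t"
| "fv (Imp \<phi> \<psi>) = fv \<phi> \<union> fv \<psi>"
| "fv (Forall \<phi>) = {i. Suc i \<in> fv \<phi>}"

fun subst_tm :: "(nat \<Rightarrow> tm) \<Rightarrow> tm \<Rightarrow> tm" where
  "subst_tm \<sigma> (Var i) = \<sigma> i"
| "subst_tm \<sigma> (App f ts) = App f (map (subst_tm \<sigma>) ts)"

fun subst :: "(nat \<Rightarrow> tm) \<Rightarrow> fm \<Rightarrow> fm" where
  "subst \<sigma> Fls = Fls"
| "subst \<sigma> (Eq s t) = Eq (subst_tm \<sigma> s) (subst_tm \<sigma> t)"
| "subst \<sigma> (Imp \<phi> \<psi>) = Imp (subst \<sigma> \<phi>) (subst \<sigma> \<psi>)"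
| "subst \<sigma> (Forall \<phi>) =
     Forall (subst (case_nat (Var 0) (\<lambda>i. subst_tm (\<lambda>j. Var (Suc j)) (\<sigma> i))) \<phi>)"

definition lift :: "fm \<Rightarrow> fm" where
  "lift \<phi> = subst (\<lambda>i. Var (Suc i)) \<phi>"

definition inst :: "tm \<Rightarrow> fm \<Rightarrow> fm" where
  "inst t \<phi> = subst (case_nat t Var) \<phi>"

text \<open>
  Classical natural deduction with equality.  In rule \<open>AllI\<close> the eigenvariable is index 0, which
  does not occur in the lifted context.
\<close>

inductive derives :: "fm list \<Rightarrow> fm \<Rightarrow> bool" where
  Hyp: "\<phi> \<in> set \<Gamma> \<Longrightarrow> wf_fm \<phi> \<Longrightarrow> derives \<Gamma> \<phi>"
| ImpI: "wf_fm \<phi> \<Longrightarrow> derives (\<phi> # \<Gamma>) \<psi> \<Longrightarrow> derives \<Gamma> (Imp \<phi> \<psi>)"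
| ImpE: "derives \<Gamma> (Imp \<phi> \<psi>) \<Longrightarrow> derives \<Gamma> \<phi> \<Longrightarrow> derives \<Gamma> \<psi>"
| RAA: "wf_fm \<phi> \<Longrightarrow> derives (Neg \<phi> # \<Gamma>) Fls \<Longrightarrow> derives \<Gamma> \<phi>"
| AllI: "derives (map lift \<Gamma>) \<phi> \<Longrightarrow> derives \<Gamma> (Forall \<phi>)"
| AllE: "derives \<Gamma> (Forall \<phi>) \<Longrightarrow> wf_tm t \<Longrightarrow> derives \<Gamma> (inst t \<phi>)"
| EqI: "wf_tm t \<Longrightarrow> derives \<Gamma> (Eq t t)"
| EqE: "derives \<Gamma> (Eq s t) \<Longrightarrow> derives \<Gamma> (inst s \<phi>) \<Longrightarrow> wf_fm \<phi> \<Longrightarrow> derives \<Gamma> (inst t \<phi>)"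

definition provable :: "fm set \<Rightarrow> fm \<Rightarrow> bool" (infix "\<tturnstile>" 50) where
  "T \<tturnstile> \<phi> \<longleftrightarrow> (\<exists>\<Gamma>. set \<Gamma> \<subseteq> T \<and> derives \<Gamma> \<phi>)"

fun qf :: "fm \<Rightarrow> bool" where
  "qf Fls = True"
| "qf (Eq s t) = True"
| "qf (Imp \<phi> \<psi>) = (qf \<phi> \<and> qf \<psi>)"
| "qf (Forall \<phi>) = False"

abbreviation zero_tm :: tm where "zero_tm \<equiv> App Zero []"
abbreviation succ_tm :: "tm \<Rightarrow> tm" where "succ_tm t \<equiv> App Succ [t]"
abbreviation add_tm :: "tm \<Rightarrow> tm \<Rightarrow> tm" where "add_tm s t \<equiv> App Add [s, t]"
abbreviation mul_tm :: "tm \<Rightarrow> tm \<Rightarrow> tm" where "mul_tm s t \<equiv> App Mul [s, t]"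
abbreviation monus_tm :: "tm \<Rightarrow> tm \<Rightarrow> tm" where "monus_tm s t \<equiv> App Monus [s, t]"

inductive_set EA_def_axioms :: "fm set" where
  Succ_nonzero: "Neg (Eq (succ_tm (Var 0)) zero_tm) \<in> EA_def_axioms"
| Succ_inj: "Imp (Eq (succ_tm (Var 0)) (succ_tm (Var 1))) (Eq (Var 0) (Var 1)) \<in> EA_def_axioms"
| Proj: "i < n \<Longrightarrow> Eq (App (Proj n i) (map Var [0..<n])) (Var i) \<in> EA_def_axioms"
| Add_0: "Eq (add_tm (Var 0) zero_tm) (Var 0) \<in> EA_def_axioms"
| Add_S: "Eq (add_tm (Var 0) (succ_tm (Var 1))) (succ_tm (add_tm (Var 0) (Var 1)))
    \<in> EA_def_axioms"
| Mul_0: "Eq (mul_tm (Var 0) zero_tm) zero_tm \<in> EA_def_axioms"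
| Mul_S: "Eq (mul_tm (Var 0) (succ_tm (Var 1))) (add_tm (mul_tm (Var 0) (Var 1)) (Var 0))
    \<in> EA_def_axioms"
| Monus_0: "Eq (monus_tm (Var 0) zero_tm) (Var 0) \<in> EA_def_axioms"
| Monus_0_S: "Eq (monus_tm zero_tm (succ_tm (Var 0))) zero_tm \<in> EA_def_axioms"
| Monus_S_S: "Eq (monus_tm (succ_tm (Var 0)) (succ_tm (Var 1))) (monus_tm (Var 0) (Var 1))
    \<in> EA_def_axioms"
| Comp: "elem_code n (Comp n f gs) \<Longrightarrow>
    Eq (App (Comp n f gs) (map Var [0..<n])) (App f (map (\<lambda>g. App g (map Var [0..<n])) gs))
    \<in> EA_def_axioms"
| BSum_0: "elem_code (Suc n) f \<Longrightarrow>
    Eq (App (BSum f) (zero_tm # map Var [1..<Suc n])) zero_tm \<in> EA_def_axioms"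
| BSum_S: "elem_code (Suc n) f \<Longrightarrow>
    Eq (App (BSum f) (succ_tm (Var 0) # map Var [1..<Suc n]))
       (add_tm (App (BSum f) (map Var [0..<Suc n])) (App f (map Var [0..<Suc n])))
    \<in> EA_def_axioms"
| BProd_0: "elem_code (Suc n) f \<Longrightarrow>
    Eq (App (BProd f) (zero_tm # map Var [1..<Suc n])) (succ_tm zero_tm) \<in> EA_def_axioms"
| BProd_S: "elem_code (Suc n) f \<Longrightarrow>
    Eq (App (BProd f) (succ_tm (Var 0) # map Var [1..<Suc n]))
       (mul_tm (App (BProd f) (map Var [0..<Suc n])) (App f (map Var [0..<Suc n])))
    \<in> EA_def_axioms"

text \<open>
  Induction on index 0 of \<open>\<phi>\<close>; the remaining free variables of \<open>\<phi>\<close> are parameters.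
\<close>

definition ind_axiom :: "fm \<Rightarrow> fm" where
  "ind_axiom \<phi> =
     Imp (And (inst zero_tm \<phi>)
              (Forall (Imp \<phi> (subst (case_nat (succ_tm (Var 0)) (\<lambda>i. Var (Suc i))) \<phi>))))
         (Forall \<phi>)"

text \<open>The axioms of EA are the universal closures of the formulas above.\<close>

definition EA :: "fm set" where
  "EA = {(Forall ^^ n) \<chi> | n \<chi>. fv \<chi> \<subseteq> {..<n} \<and>
           (\<chi> \<in> EA_def_axioms \<or> (\<exists>\<phi>. wf_fm \<phi> \<and> qf \<phi> \<and> \<chi> = ind_axiom \<phi>))}"

text \<open>
  Bounded quantifiers are expressible by quantifier-free formulas through bounded sums and
  products, so the matrix of a \<open>\<Sigma>\<^sub>1\<close> formula may be taken quantifier-free.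
\<close>

definition sigma1 :: "fm \<Rightarrow> bool" where
  "sigma1 \<phi> \<longleftrightarrow> (\<exists>n \<theta>. qf \<theta> \<and> \<phi> = ((\<lambda>\<chi>. Exists \<chi>) ^^ n) \<theta>)"

inductive bool_comb :: "(fm \<Rightarrow> bool) \<Rightarrow> fm \<Rightarrow> bool" for P where
  "P \<phi> \<Longrightarrow> bool_comb P \<phi>"
| "bool_comb P \<phi> \<Longrightarrow> bool_comb P (Neg \<phi>)"
| "bool_comb P \<phi> \<Longrightarrow> bool_comb P \<psi> \<Longrightarrow> bool_comb P (And \<phi> \<psi>)"
| "bool_comb P \<phi> \<Longrightarrow> bool_comb P \<psi> \<Longrightarrow> bool_comb P (Or \<phi> \<psi>)"

end

theory Submission
  imports Defs "HOL-Library.Countable"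
begin

text \<open>
  Only the shape of EA matters: it is axiomatised by universal-existential sentences (for
  induction: if \<open>\<phi>(0)\<close> and not \<open>\<phi>(a)\<close>, then there is a \<open>w\<close> with \<open>\<phi>(w)\<close> and not
  \<open>\<phi>(Suc w)\<close>).  Consider a student who asks, one after the other, for a \<open>y\<close> with
  \<open>A(t, y, c)\<close>, for a \<open>u\<close> with \<open>\<not> B(t, u, c)\<close>, or for a witness of an existential theorem of
  EA; the terms may mention the earlier answers.  If every request could be answered forever, the
  values of all terms in the answers would form a submodel of EA in which
  \<open>\<forall>x. \<exists>y. A\<close> holds and \<open>\<exists>z. \<forall>u. B\<close> fails.  By compactness there is a fixed finite list of
  requests that cannot all be answered, provably in EA.  Let \<open>E\<^sub>i\<close> be the \<open>\<Sigma>\<^sub>1\<close> formula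
  saying that the first \<open>i\<close> requests have answers, and let \<open>i\<close> be maximal with \<open>E\<^sub>i\<close>.  The
  next request is unanswerable, hence is not an existential theorem; if it asks for a
  \<open>y\<close> then \<open>\<forall>x. \<exists>y. A\<close> fails, and if it asks for a \<open>u\<close> then \<open>\<exists>z. \<forall>u. B\<close> holds.
  So \<open>\<exists>z. \<forall>u. B\<close> is equivalent to the disjunction of \<open>E\<^sub>i \<and> \<not> E\<^bsub>i+1\<^esub>\<close> over the \<open>i\<close>
  for which the next request asks for a \<open>u\<close>.
\<close>

text \<open>Formulas are enumerated through \<open>from_nat\<close> twice: to add the Henkin axioms
  and to list the requests.\<close>

instance code :: countable by countable_datatype
instance tm :: countable by countable_datatype
instance fm :: countable by countable_datatype

section \<open>Substitution\<close>

abbreviation up :: "(nat \<Rightarrow> tm) \<Rightarrow> nat \<Rightarrow> tm" where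
  "up \<sigma> \<equiv> case_nat (Var 0) (\<lambda>i. subst_tm (\<lambda>j. Var (Suc j)) (\<sigma> i))"

lemma subst_tm_cong: "(\<And>i. i \<in> fv_tm t \<Longrightarrow> \<sigma> i = \<tau> i) \<Longrightarrow> subst_tm \<sigma> t = subst_tm \<tau> t"
  by (induction t) auto

lemma subst_cong: "(\<And>i. i \<in> fv \<phi> \<Longrightarrow> \<sigma> i = \<tau> i) \<Longrightarrow> subst \<sigma> \<phi> = subst \<tau> \<phi>"
proof (induction \<phi> arbitrary: \<sigma> \<tau>)
  case (Eq s t)
  then show ?case by (auto intro!: subst_tm_cong)
next
  case (Imp \<phi> \<psi>)
  from Imp.IH(1)[of \<sigma> \<tau>] Imp.IH(2)[of \<sigma> \<tau>] Imp.prems show ?case by auto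
next
  case (Forall \<phi>)
  show ?case
    unfolding subst.simps fm.inject
    by (rule Forall.IH)
      (auto split: nat.split intro!: arg_cong[where f = "subst_tm _"] Forall.prems)
qed simp

lemma subst_tm_Var [simp]: "subst_tm Var t = t"
  by (induction t) (auto simp: map_idI)

lemma subst_Var [simp]: "subst Var \<phi> = \<phi>"
proof (induction \<phi>)
  case (Forall \<phi>)
  have "up Var = Var" by (auto simp: fun_eq_iff split: nat.split)
  with Forall show ?case by simp
qed auto

lemma subst_tm_comp: "subst_tm \<sigma> (subst_tm \<tau> t) = subst_tm (\<lambda>i. subst_tm \<sigma> (\<tau> i)) t"
  by (induction t) auto

lemma subst_comp: "subst \<sigma> (subst \<tau> \<phi>) = subst (\<lambda>i. subst_tm \<sigma> (\<tau> i)) \<phi>"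
proof (induction \<phi> arbitrary: \<sigma> \<tau>)
  case (Forall \<phi>)
  have "(\<lambda>i. subst_tm (up \<sigma>) (up \<tau> i)) = up (\<lambda>i. subst_tm \<sigma> (\<tau> i))"
    by (auto simp: fun_eq_iff subst_tm_comp split: nat.split)
  with Forall show ?case by simp
qed (auto simp: subst_tm_comp)

lemma subst_up_lift: "subst (up \<sigma>) (lift \<phi>) = lift (subst \<sigma> \<phi>)"
  by (simp add: lift_def subst_comp)

lemma inst_subst_up: "inst t (subst (up \<sigma>) \<phi>) = subst (case_nat t \<sigma>) \<phi>"
  unfolding inst_def subst_comp
  by (rule arg_cong[where f = "\<lambda>\<sigma>. subst \<sigma> \<phi>"])
    (auto simp: fun_eq_iff subst_tm_comp split: nat.split)

lemma subst_inst: "subst \<sigma> (inst t \<phi>) = inst (subst_tm \<sigma> t) (subst (up \<sigma>) \<phi>)"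
  unfolding inst_subst_up unfolding inst_def subst_comp
  by (rule arg_cong[where f = "\<lambda>\<sigma>. subst \<sigma> \<phi>"]) (auto simp: fun_eq_iff split: nat.split)

lemma wf_subst_tm: "wf_tm t \<Longrightarrow> (\<And>i. wf_tm (\<sigma> i)) \<Longrightarrow> wf_tm (subst_tm \<sigma> t)"
  by (induction t) auto

lemma wf_up: "(\<And>i. wf_tm (\<sigma> i)) \<Longrightarrow> wf_tm (up \<sigma> i)"
  by (auto split: nat.split intro: wf_subst_tm)

lemma wf_subst: "wf_fm \<phi> \<Longrightarrow> (\<And>i. wf_tm (\<sigma> i)) \<Longrightarrow> wf_fm (subst \<sigma> \<phi>)"
proof (induction \<phi> arbitrary: \<sigma>)
  case (Forall \<phi>)
  then show ?case using wf_up[of \<sigma>] by simp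
qed (auto intro: wf_subst_tm)

lemma wf_inst: "wf_fm \<phi> \<Longrightarrow> wf_tm t \<Longrightarrow> wf_fm (inst t \<phi>)"
  unfolding inst_def by (rule wf_subst) (auto split: nat.split)

lemma qf_subst [simp]: "qf (subst \<sigma> \<phi>) = qf \<phi>"
  by (induction \<phi> arbitrary: \<sigma>) auto

lemma fv_subst_tm: "fv_tm (subst_tm \<sigma> t) = (\<Union>i\<in>fv_tm t. fv_tm (\<sigma> i))"
  by (induction t) auto

lemma fv_subst: "fv (subst \<sigma> \<phi>) = (\<Union>i\<in>fv \<phi>. fv_tm (\<sigma> i))"
proof (induction \<phi> arbitrary: \<sigma>)
  case (Forall \<phi>)
  have "Suc i \<in> fv_tm (up \<sigma> j) \<longleftrightarrow> (\<exists>k. j = Suc k \<and> i \<in> fv_tm (\<sigma> k))" for i j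
    by (cases j) (auto simp: fv_subst_tm)
  then show ?case by (auto simp: Forall.IH)
qed (auto simp: fv_subst_tm)

lemma finite_fv_tm [simp]: "finite (fv_tm t)"
  by (induction t) auto

lemma finite_fv [simp]: "finite (fv \<phi>)"
proof (induction \<phi>)
  case (Forall \<phi>)
  then show ?case by (auto intro: finite_imageD[of Suc] finite_subset[of _ "fv \<phi>"])
qed auto

section \<open>Structural properties of derivability\<close>

lemma derives_weaken: "derives \<Gamma> \<phi> \<Longrightarrow> set \<Gamma> \<subseteq> set \<Delta> \<Longrightarrow> derives \<Delta> \<phi>"
proof (induction arbitrary: \<Delta> rule: derives.induct)
  case (ImpI \<phi> \<Gamma> \<psi>)
  show ?case by (rule derives.ImpI[OF ImpI(1) ImpI.IH]) (use ImpI.prems in auto)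
next
  case (RAA \<phi> \<Gamma>)
  show ?case by (rule derives.RAA[OF RAA(1) RAA.IH]) (use RAA.prems in auto)
next
  case (AllI \<Gamma> \<phi>)
  show ?case by (rule derives.AllI[OF AllI.IH]) (use AllI.prems in auto)
qed (auto intro: derives.intros)

lemma derives_wf: "derives \<Gamma> \<phi> \<Longrightarrow> wf_fm \<phi>"
  by (induction rule: derives.induct) (auto intro: wf_inst)

lemma derives_subst:
  "derives \<Gamma> \<phi> \<Longrightarrow> (\<And>i. wf_tm (\<sigma> i)) \<Longrightarrow> derives (map (subst \<sigma>) \<Gamma>) (subst \<sigma> \<phi>)"
proof (induction arbitrary: \<sigma> rule: derives.induct)
  case (Hyp \<phi> \<Gamma>)
  then show ?case by (simp add: derives.Hyp wf_subst)
next
  case (ImpI \<phi> \<Gamma> \<psi>)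
  then show ?case by (auto intro: derives.ImpI wf_subst)
next
  case (ImpE \<Gamma> \<phi> \<psi>)
  then show ?case by (auto intro: derives.ImpE)
next
  case (RAA \<phi> \<Gamma>)
  then show ?case using RAA.IH[of \<sigma>] by (auto intro: derives.RAA wf_subst)
next
  case (AllI \<Gamma> \<phi>)
  have "derives (map (subst (up \<sigma>)) (map lift \<Gamma>)) (subst (up \<sigma>) \<phi>)"
    by (rule AllI.IH) (rule wf_up[OF AllI.prems])
  then show ?case by (auto intro!: derives.AllI simp: comp_def subst_up_lift)
next
  case (AllE \<Gamma> \<phi> t)
  then show ?case by (simp add: subst_inst derives.AllE wf_subst_tm)
next
  case (EqI t \<Gamma>)
  then show ?case by (simp add: derives.EqI wf_subst_tm)
next
  case (EqE \<Gamma> s t \<phi>)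
  have "wf_fm (subst (up \<sigma>) \<phi>)" by (rule wf_subst[OF EqE.hyps(3)]) (rule wf_up[OF EqE.prems])
  with EqE.IH(1)[OF EqE.prems] EqE.IH(2)[OF EqE.prems] show ?case
    unfolding subst_inst subst.simps by (rule derives.EqE)
qed

text \<open>Renaming \<open>v\<close> to index 0 and shifting all other variables acts on the
  context as \<open>lift\<close> and turns the instance back into \<open>\<phi>\<close>, so a named
  fresh variable can serve as eigenvariable.\<close>

lemma derives_Forall_fresh:
  assumes "derives \<Gamma> (inst (Var v) \<phi>)" "\<And>\<psi>. \<psi> \<in> set \<Gamma> \<Longrightarrow> v \<notin> fv \<psi>" "Suc v \<notin> fv \<phi>"
  shows "derives \<Gamma> (Forall \<phi>)"
proof (rule derives.AllI)
  define \<sigma> where "\<sigma> = (\<lambda>i. if i = v then Var 0 else Var (Suc i))"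
  have "map (subst \<sigma>) \<Gamma> = map lift \<Gamma>"
    using assms(2) by (fastforce simp: lift_def \<sigma>_def intro: subst_cong)
  moreover have "subst \<sigma> (inst (Var v) \<phi>) = subst Var \<phi>"
    unfolding inst_def subst_comp
    by (rule subst_cong) (use assms(3) in \<open>auto simp: \<sigma>_def split: nat.split\<close>)
  moreover have "derives (map (subst \<sigma>) \<Gamma>) (subst \<sigma> (inst (Var v) \<phi>))"
    by (rule derives_subst[OF assms(1)]) (simp add: \<sigma>_def)
  ultimately show "derives (map lift \<Gamma>) \<phi>" by (simp only: subst_Var)
qed

lemma provable_mono: "T \<tturnstile> \<phi> \<Longrightarrow> T \<subseteq> U \<Longrightarrow> U \<tturnstile> \<phi>"
  unfolding provable_def by blast

lemma provable_hyp: "\<phi> \<in> T \<Longrightarrow> wf_fm \<phi> \<Longrightarrow> T \<tturnstile> \<phi>"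
  unfolding provable_def by (intro exI[of _ "[\<phi>]"]) (auto intro: derives.Hyp)

lemma derives_insert:
  assumes "insert \<phi> T \<tturnstile> \<psi>"
  obtains \<Gamma> where "set \<Gamma> \<subseteq> T" "derives (\<phi> # \<Gamma>) \<psi>"
proof -
  from assms obtain \<Gamma> where "set \<Gamma> \<subseteq> insert \<phi> T" "derives \<Gamma> \<psi>"
    unfolding provable_def by blast
  then have "set (filter (\<lambda>\<chi>. \<chi> \<in> T) \<Gamma>) \<subseteq> T" "derives (\<phi> # filter (\<lambda>\<chi>. \<chi> \<in> T) \<Gamma>) \<psi>"
    by (auto elim!: derives_weaken)
  then show thesis using that by blast
qed

lemma provable_ImpI: "insert \<phi> T \<tturnstile> \<psi> \<Longrightarrow> wf_fm \<phi> \<Longrightarrow> T \<tturnstile> Imp \<phi> \<psi>"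
  by (elim derives_insert) (auto simp: provable_def intro: derives.ImpI)

lemma provable_RAA: "insert (Neg \<phi>) T \<tturnstile> Fls \<Longrightarrow> wf_fm \<phi> \<Longrightarrow> T \<tturnstile> \<phi>"
  by (elim derives_insert) (auto simp: provable_def intro: derives.RAA)

lemma provable_ImpE:
  assumes "T \<tturnstile> Imp \<phi> \<psi>" "T \<tturnstile> \<phi>"
  shows "T \<tturnstile> \<psi>"
proof -
  from assms obtain \<Gamma> \<Delta> where "set \<Gamma> \<subseteq> T" "derives \<Gamma> (Imp \<phi> \<psi>)" "set \<Delta> \<subseteq> T" "derives \<Delta> \<phi>"
    unfolding provable_def by blast
  then show ?thesis unfolding provable_def
    by (intro exI[of _ "\<Gamma> @ \<Delta>"] conjI derives.ImpE[of "\<Gamma> @ \<Delta>" \<phi> \<psi>]) (auto intro: derives_weaken)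
qed

lemma provable_EqE:
  assumes "T \<tturnstile> Eq s t" "T \<tturnstile> inst s \<phi>" "wf_fm \<phi>"
  shows "T \<tturnstile> inst t \<phi>"
proof -
  from assms obtain \<Gamma> \<Delta> where "set \<Gamma> \<subseteq> T" "derives \<Gamma> (Eq s t)" "set \<Delta> \<subseteq> T" "derives \<Delta> (inst s \<phi>)"
    unfolding provable_def by blast
  then show ?thesis unfolding provable_def
    by (intro exI[of _ "\<Gamma> @ \<Delta>"] conjI derives.EqE[of "\<Gamma> @ \<Delta>" s t \<phi>] assms)
      (auto intro: derives_weaken)
qed

lemma provable_AllE: "T \<tturnstile> Forall \<phi> \<Longrightarrow> wf_tm t \<Longrightarrow> T \<tturnstile> inst t \<phi>"
  unfolding provable_def by (blast intro: derives.AllE)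

lemma provable_EqI: "wf_tm t \<Longrightarrow> T \<tturnstile> Eq t t"
  unfolding provable_def by (intro exI[of _ "[]"]) (auto intro: derives.EqI)

section \<open>Structures and soundness\<close>

text \<open>\<open>D\<close> is the domain; \<open>I\<close> is total, but only its values on lists in \<open>D\<close> of the right arity matter.\<close>

fun eval :: "(code \<Rightarrow> 'a list \<Rightarrow> 'a) \<Rightarrow> (nat \<Rightarrow> 'a) \<Rightarrow> tm \<Rightarrow> 'a" where
  "eval I e (Var i) = e i"
| "eval I e (App f ts) = I f (map (eval I e) ts)"

fun sat :: "'a set \<Rightarrow> (code \<Rightarrow> 'a list \<Rightarrow> 'a) \<Rightarrow> (nat \<Rightarrow> 'a) \<Rightarrow> fm \<Rightarrow> bool" where
  "sat D I e Fls = False"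
| "sat D I e (Eq s t) = (eval I e s = eval I e t)"
| "sat D I e (Imp \<phi> \<psi>) = (sat D I e \<phi> \<longrightarrow> sat D I e \<psi>)"
| "sat D I e (Forall \<phi>) = (\<forall>d\<in>D. sat D I (case_nat d e) \<phi>)"

text \<open>Bundling the environment with the structure keeps the domain nonempty.\<close>

definition struct :: "'a set \<Rightarrow> (code \<Rightarrow> 'a list \<Rightarrow> 'a) \<Rightarrow> (nat \<Rightarrow> 'a) \<Rightarrow> bool" where
  "struct D I e \<longleftrightarrow> range e \<subseteq> D \<and> (\<forall>f ds. elem_code (length ds) f \<longrightarrow> set ds \<subseteq> D \<longrightarrow> I f ds \<in> D)"

lemma struct_env: "struct D I e \<Longrightarrow> e i \<in> D"
  by (auto simp: struct_def)

lemma struct_change: "struct D I e \<Longrightarrow> (\<And>i. e' i \<in> D) \<Longrightarrow> struct D I e'"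
  by (auto simp: struct_def)

lemma struct_case_nat: "struct D I e \<Longrightarrow> d \<in> D \<Longrightarrow> struct D I (case_nat d e)"
  by (auto simp: struct_def image_subset_iff split: nat.split)

lemma eval_in: "struct D I e \<Longrightarrow> wf_tm t \<Longrightarrow> eval I e t \<in> D"
proof (induction t)
  case (App f ts)
  then have "set (map (eval I e) ts) \<subseteq> D" by auto
  with App.prems show ?case by (simp add: struct_def)
qed (auto simp: struct_def)

lemma eval_cong: "(\<And>i. i \<in> fv_tm t \<Longrightarrow> e i = e' i) \<Longrightarrow> eval I e t = eval I e' t"
proof (induction t)
  case (App f ts)
  then have "map (eval I e) ts = map (eval I e') ts" by auto
  then show ?case unfolding eval.simps by (rule arg_cong)
qed simp

lemma sat_cong: "(\<And>i. i \<in> fv \<phi> \<Longrightarrow> e i = e' i) \<Longrightarrow> sat D I e \<phi> = sat D I e' \<phi>"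
proof (induction \<phi> arbitrary: e e')
  case (Eq s t)
  then show ?case using eval_cong[of s e e' I] eval_cong[of t e e' I] by auto
next
  case (Imp \<phi> \<psi>)
  from Imp.IH(1)[of e e'] Imp.IH(2)[of e e'] Imp.prems show ?case by auto
next
  case (Forall \<phi>)
  have "sat D I (case_nat d e) \<phi> = sat D I (case_nat d e') \<phi>" for d
    by (rule Forall.IH) (auto split: nat.split intro: Forall.prems)
  then show ?case by simp
qed simp

lemma eval_subst: "eval I e (subst_tm \<sigma> t) = eval I (\<lambda>i. eval I e (\<sigma> i)) t"
proof (induction t)
  case (App f ts)
  then have "map (eval I e) (map (subst_tm \<sigma>) ts) = map (eval I (\<lambda>i. eval I e (\<sigma> i))) ts" by auto
  then show ?case unfolding subst_tm.simps eval.simps by (rule arg_cong)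
qed simp

lemma sat_subst: "sat D I e (subst \<sigma> \<phi>) = sat D I (\<lambda>i. eval I e (\<sigma> i)) \<phi>"
proof (induction \<phi> arbitrary: e \<sigma>)
  case (Forall \<phi>)
  have "(\<lambda>i. eval I (case_nat d e) (up \<sigma> i)) = case_nat d (\<lambda>i. eval I e (\<sigma> i))" for d
    by (auto simp: fun_eq_iff eval_subst split: nat.split)
  with Forall show ?case by simp
qed (auto simp: eval_subst)

lemma sat_inst: "sat D I e (inst t \<phi>) = sat D I (case_nat (eval I e t) e) \<phi>"
  unfolding inst_def sat_subst by (rule sat_cong) (auto split: nat.split)

lemma sat_lift: "sat D I (case_nat d e) (lift \<phi>) = sat D I e \<phi>"
  unfolding lift_def sat_subst by simp

text \<open>Quantifier-free truth never consults the domain; this carries the answers over to the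
  submodel in \<open>inconsistent\<close>.\<close>

lemma sat_qf: "qf \<phi> \<Longrightarrow> sat D I e \<phi> = sat D' I e \<phi>"
  by (induction \<phi>) auto

theorem derives_sound:
  "derives \<Gamma> \<phi> \<Longrightarrow> struct D I e \<Longrightarrow> (\<And>\<psi>. \<psi> \<in> set \<Gamma> \<Longrightarrow> sat D I e \<psi>) \<Longrightarrow> sat D I e \<phi>"
proof (induction arbitrary: e rule: derives.induct)
  case (ImpI \<phi> \<Gamma> \<psi>)
  then show ?case by fastforce
next
  case (RAA \<phi> \<Gamma>)
  then show ?case by fastforce
next
  case (AllI \<Gamma> \<phi>)
  show ?case unfolding sat.simps
  proof
    fix d assume "d \<in> D"
    then show "sat D I (case_nat d e) \<phi>"
      by (intro AllI.IH struct_case_nat AllI.prems) (use AllI.prems in \<open>auto simp: sat_lift\<close>)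
  qed
next
  case (AllE \<Gamma> \<phi> t)
  then show ?case using eval_in by (fastforce simp: sat_inst)
next
  case (EqE \<Gamma> s t \<phi>)
  then show ?case by (auto simp: sat_inst)
qed auto

section \<open>Completeness\<close>

lemma provable_exfalso: "T \<tturnstile> Fls \<Longrightarrow> wf_fm \<phi> \<Longrightarrow> T \<tturnstile> \<phi>"
  by (rule provable_RAA, rule provable_mono) auto

text \<open>A derivation of \<open>Fls\<close> uses finitely many hypotheses, and these already lie
  in one member of the chain.\<close>

lemma consistent_Union_chain:
  assumes "\<C> \<noteq> {}" "subset.chain \<A> \<C>" "\<And>X. X \<in> \<C> \<Longrightarrow> \<not> X \<tturnstile> Fls"
  shows "\<not> \<Union>\<C> \<tturnstile> Fls"
proof
  assume "\<Union>\<C> \<tturnstile> Fls"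
  then obtain \<Gamma> where \<Gamma>: "set \<Gamma> \<subseteq> \<Union>\<C>" "derives \<Gamma> Fls"
    unfolding provable_def by blast
  obtain X where "X \<in> \<C>" "set \<Gamma> \<subseteq> X"
    using finite_subset_Union_chain[OF _ \<Gamma>(1) assms(1,2)] by auto
  with \<Gamma>(2) assms(3) show False unfolding provable_def by blast
qed

text \<open>If the Henkin axiom were refutable from \<open>X\<close>, then \<open>X\<close> would
  prove the instance at \<open>v\<close> (its negation yields the axiom vacuously), hence by
  freshness the universal formula, hence the axiom itself.\<close>

lemma consistent_insert_henkin:
  assumes "\<not> X \<tturnstile> Fls" "wf_fm \<phi>" and fresh: "\<And>\<psi>. \<psi> \<in> X \<Longrightarrow> v \<notin> fv \<psi>" "Suc v \<notin> fv \<phi>"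
  shows "\<not> insert (Imp (inst (Var v) \<phi>) (Forall \<phi>)) X \<tturnstile> Fls"
proof
  let ?\<phi>v = "inst (Var v) \<phi>"
  let ?H = "Imp ?\<phi>v (Forall \<phi>)"
  have wf: "wf_fm ?\<phi>v" "wf_fm ?H" using assms(2) by (auto intro: wf_inst)
  assume "insert ?H X \<tturnstile> Fls"
  then have neg: "X \<tturnstile> Neg ?H" using wf(2) by (rule provable_ImpI)
  have "insert ?\<phi>v (insert (Neg ?\<phi>v) X) \<tturnstile> Fls"
    by (rule provable_ImpE[of _ ?\<phi>v]; rule provable_hyp) (use wf in auto)
  then have "insert ?\<phi>v (insert (Neg ?\<phi>v) X) \<tturnstile> Forall \<phi>"
    by (rule provable_exfalso) (use assms(2) in auto)
  then have "insert (Neg ?\<phi>v) X \<tturnstile> ?H" using wf(1) by (rule provable_ImpI)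
  then have "insert (Neg ?\<phi>v) X \<tturnstile> Fls"
    using provable_ImpE[OF provable_mono[OF neg]] by blast
  then have "X \<tturnstile> ?\<phi>v" using wf(1) by (rule provable_RAA)
  then obtain \<Gamma> where "set \<Gamma> \<subseteq> X" "derives \<Gamma> ?\<phi>v"
    unfolding provable_def by blast
  moreover from this have "derives \<Gamma> (Forall \<phi>)"
    by (elim derives_Forall_fresh) (use fresh in auto)
  ultimately have "X \<tturnstile> Forall \<phi>" unfolding provable_def by blast
  then have "insert ?\<phi>v X \<tturnstile> Forall \<phi>" by (rule provable_mono) blast
  then have "X \<tturnstile> ?H" using wf(1) by (rule provable_ImpI)
  with neg have "X \<tturnstile> Fls" by (rule provable_ImpE)
  with assms(1) show False ..
qed

lemma henkin_extension:
  assumes "\<not> X \<tturnstile> Fls" "infinite (UNIV - \<Union>(fv ` X))"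
  obtains Y where "X \<subseteq> Y" "\<not> Y \<tturnstile> Fls"
    "\<And>\<phi>. wf_fm \<phi> \<Longrightarrow> \<exists>v. Imp (inst (Var v) \<phi>) (Forall \<phi>) \<in> Y"
proof -
  define fresh where "fresh Z \<phi> = (SOME v. v \<notin> \<Union>(fv ` Z) \<and> Suc v \<notin> fv \<phi>)" for Z \<phi>
  define F where "F = rec_nat X (\<lambda>n Z. let \<phi> = from_nat n in
    if wf_fm \<phi> then insert (Imp (inst (Var (fresh Z \<phi>)) \<phi>) (Forall \<phi>)) Z else Z)"
  have F0: "F 0 = X" by (simp add: F_def)
  have FS: "F (Suc n) = (if wf_fm (from_nat n)
      then insert (Imp (inst (Var (fresh (F n) (from_nat n))) (from_nat n)) (Forall (from_nat n))) (F n)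
      else F n)" for n
    by (simp add: F_def Let_def)
  \<comment> \<open>Each stage adds at most one formula and so uses up only finitely many variables;
    fresh ones always remain.\<close>
  have inv: "\<not> F n \<tturnstile> Fls \<and> infinite (UNIV - \<Union>(fv ` F n))" for n
  proof (induction n)
    case 0
    then show ?case using assms F0 by simp
  next
    case (Suc n)
    let ?\<phi> = "from_nat n :: fm"
    have "finite {v. Suc v \<in> fv ?\<phi>}"
      using finite_fv[of "Forall ?\<phi>"] by simp
    then have "infinite (UNIV - \<Union>(fv ` F n) - {v. Suc v \<in> fv ?\<phi>})"
      using Suc by (simp add: Diff_infinite_finite)
    from infinite_imp_nonempty[OF this] obtain v
      where "v \<notin> \<Union>(fv ` F n) \<and> Suc v \<notin> fv ?\<phi>"
      by blast
    then have "fresh (F n) ?\<phi> \<notin> \<Union>(fv ` F n) \<and> Suc (fresh (F n) ?\<phi>) \<notin> fv ?\<phi>"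
      unfolding fresh_def by (rule someI)
    then have "\<not> F (Suc n) \<tturnstile> Fls"
      using Suc consistent_insert_henkin[of "F n" ?\<phi> "fresh (F n) ?\<phi>"] by (auto simp: FS)
    moreover have "infinite (UNIV - \<Union>(fv ` insert \<psi> (F n)))" for \<psi>
    proof -
      have "UNIV - \<Union>(fv ` insert \<psi> (F n)) = (UNIV - \<Union>(fv ` F n)) - fv \<psi>" by auto
      then show ?thesis using Suc by (simp add: Diff_infinite_finite)
    qed
    ultimately show ?case using Suc by (auto simp only: FS split: if_split)
  qed
  have "F n \<subseteq> F (Suc n)" for n by (auto simp: FS)
  then have mono: "m \<le> n \<Longrightarrow> F m \<subseteq> F n" for m n by (rule lift_Suc_mono_le)
  show thesis
  proof
    show "X \<subseteq> \<Union>(range F)" using F0 by blast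
    have "F m \<subseteq> F n \<or> F n \<subseteq> F m" for m n using mono nat_le_linear[of m n] by blast
    then have "subset.chain UNIV (range F)" unfolding subset_chain_def by simp
    then show "\<not> \<Union>(range F) \<tturnstile> Fls"
      by (rule consistent_Union_chain[rotated]) (use inv in auto)
    fix \<phi> assume "wf_fm \<phi>"
    then show "\<exists>v. Imp (inst (Var v) \<phi>) (Forall \<phi>) \<in> \<Union>(range F)"
      using FS[of "to_nat \<phi>"] by (intro exI UN_I[of "Suc (to_nat \<phi>)"]) auto
  qed
qed

lemma lindenbaum:
  assumes "\<not> Y \<tturnstile> Fls"
  obtains M where "Y \<subseteq> M" "\<not> M \<tturnstile> Fls" "\<And>\<phi>. \<not> insert \<phi> M \<tturnstile> Fls \<Longrightarrow> \<phi> \<in> M"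
proof -
  let ?\<A> = "{X. Y \<subseteq> X \<and> \<not> X \<tturnstile> Fls}"
  have "\<exists>M\<in>?\<A>. \<forall>X\<in>?\<A>. M \<subseteq> X \<longrightarrow> X = M"
  proof (rule subset_Zorn_nonempty)
    show "?\<A> \<noteq> {}" using assms by auto
    fix \<C> assume \<C>: "\<C> \<noteq> {}" "subset.chain ?\<A> \<C>"
    then have sub: "\<C> \<subseteq> ?\<A>" by (simp add: subset_chain_def)
    have "\<not> \<Union>\<C> \<tturnstile> Fls" by (rule consistent_Union_chain[OF \<C>]) (use sub in auto)
    moreover have "Y \<subseteq> \<Union>\<C>" using sub \<C>(1) by blast
    ultimately show "\<Union>\<C> \<in> ?\<A>" by simp
  qed
  then obtain M where "M \<in> ?\<A>" and max: "\<forall>X\<in>?\<A>. M \<subseteq> X \<longrightarrow> X = M" ..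
  then have M: "Y \<subseteq> M" "\<not> M \<tturnstile> Fls" by auto
  show thesis
  proof (rule that[OF M])
    fix \<phi> assume "\<not> insert \<phi> M \<tturnstile> Fls"
    then have "insert \<phi> M \<in> ?\<A>" using M(1) by auto
    with max have "insert \<phi> M = M" by blast
    then show "\<phi> \<in> M" by blast
  qed
qed

section \<open>Term model of a maximal consistent Henkin set\<close>

locale max_henkin =
  fixes M :: "fm set"
  assumes con: "\<not> M \<tturnstile> Fls"
    and max: "\<And>\<phi>. \<not> insert \<phi> M \<tturnstile> Fls \<Longrightarrow> \<phi> \<in> M"
    and henkin: "\<And>\<phi>. wf_fm \<phi> \<Longrightarrow> \<exists>v. Imp (inst (Var v) \<phi>) (Forall \<phi>) \<in> M"
begin

lemma provable_iff: "wf_fm \<phi> \<Longrightarrow> M \<tturnstile> \<phi> \<longleftrightarrow> \<phi> \<in> M"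
  using con max provable_ImpE[of M \<phi> Fls] provable_ImpI[of \<phi> M Fls] provable_hyp[of \<phi> M] by blast

lemma Fls_notin: "Fls \<notin> M"
  using con provable_hyp by force

lemma Imp_iff:
  assumes "wf_fm \<phi>" "wf_fm \<psi>"
  shows "Imp \<phi> \<psi> \<in> M \<longleftrightarrow> (\<phi> \<in> M \<longrightarrow> \<psi> \<in> M)"
proof
  assume "Imp \<phi> \<psi> \<in> M"
  then show "\<phi> \<in> M \<longrightarrow> \<psi> \<in> M"
    using assms provable_ImpE[of M \<phi> \<psi>] provable_hyp[of _ M] provable_iff[of \<psi>] by auto
next
  assume "\<phi> \<in> M \<longrightarrow> \<psi> \<in> M"
  then have "insert \<phi> M \<tturnstile> \<psi>"
    using assms max[of \<phi>] provable_exfalso[of "insert \<phi> M" \<psi>] provable_hyp[of \<psi> "insert \<phi> M"]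
    by blast
  then have "M \<tturnstile> Imp \<phi> \<psi>" using assms(1) by (rule provable_ImpI)
  then show "Imp \<phi> \<psi> \<in> M" using assms by (simp add: provable_iff)
qed

lemma Forall_iff:
  assumes "wf_fm \<phi>"
  shows "Forall \<phi> \<in> M \<longleftrightarrow> (\<forall>t. wf_tm t \<longrightarrow> inst t \<phi> \<in> M)"
proof
  assume "Forall \<phi> \<in> M"
  then show "\<forall>t. wf_tm t \<longrightarrow> inst t \<phi> \<in> M"
    using assms provable_AllE[of M \<phi>] by (simp add: provable_iff wf_inst)
next
  assume *: "\<forall>t. wf_tm t \<longrightarrow> inst t \<phi> \<in> M"
  obtain v where "Imp (inst (Var v) \<phi>) (Forall \<phi>) \<in> M" using henkin[OF assms] ..
  then show "Forall \<phi> \<in> M" using * assms by (simp add: Imp_iff wf_inst)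
qed

abbreviation shift :: "tm \<Rightarrow> tm" where "shift \<equiv> subst_tm (\<lambda>i. Var (Suc i))"

lemma inst_shift: "subst_tm (case_nat t Var) (shift s) = s"
  by (simp add: subst_tm_comp)

lemma Eq_refl: "wf_tm t \<Longrightarrow> Eq t t \<in> M"
  using provable_EqI[of t M] provable_iff[of "Eq t t"] by simp

lemma wf_shift: "wf_tm t \<Longrightarrow> wf_tm (shift t)"
  by (rule wf_subst_tm) auto

lemma Eq_replace:
  assumes "Eq s t \<in> M" "wf_tm s" "wf_tm t" "inst s \<phi> \<in> M" "wf_fm \<phi>"
  shows "inst t \<phi> \<in> M"
  using assms provable_EqE[of M s t \<phi>] by (simp add: provable_iff wf_inst)

lemma Eq_sym:
  assumes "Eq s t \<in> M" "wf_tm s" "wf_tm t"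
  shows "Eq t s \<in> M"
  using Eq_replace[OF assms, of "Eq (Var 0) (shift s)"] assms
  by (simp add: inst_def inst_shift Eq_refl wf_shift)

lemma Eq_trans:
  assumes "Eq s t \<in> M" "Eq t u \<in> M" "wf_tm s" "wf_tm t" "wf_tm u"
  shows "Eq s u \<in> M"
  using Eq_replace[OF assms(2,4,5), of "Eq (shift s) (Var 0)"] assms
  by (simp add: inst_def inst_shift wf_shift)

text \<open>Arguments are exchanged one at a time; \<open>rs\<close> collects those already dealt
  with.\<close>

lemma Eq_App:
  assumes "list_all2 (\<lambda>s t. wf_tm s \<and> wf_tm t \<and> Eq s t \<in> M) ss ts"
    and "elem_code (length rs + length ss) f" "\<forall>r\<in>set rs. wf_tm r"
  shows "Eq (App f (rs @ ss)) (App f (rs @ ts)) \<in> M"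
  using assms
proof (induction arbitrary: rs rule: list_all2_induct)
  case Nil
  then show ?case by (auto intro: Eq_refl)
next
  case (Cons s ss t ts)
  have wfs: "\<forall>r\<in>set ss. wf_tm r" "\<forall>r\<in>set ts. wf_tm r" "length ss = length ts"
    using Cons(2) by (auto simp: list_all2_conv_all_nth in_set_conv_nth)
  \<comment> \<open>Index 0 marks the argument being exchanged; shifting protects the other terms
    from the instantiation.\<close>
  let ?\<phi> = "Eq (shift (App f (rs @ s # ss))) (App f (map shift rs @ Var 0 # map shift ss))"
  have "inst t ?\<phi> \<in> M"
    by (rule Eq_replace[of s])
      (use Cons.hyps Cons.prems wfs in \<open>auto simp: inst_def inst_shift wf_shift comp_def map_idI intro!: Eq_refl\<close>)
  then have "Eq (App f (rs @ s # ss)) (App f (rs @ t # ss)) \<in> M"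
    by (simp add: inst_def inst_shift comp_def map_idI)
  moreover have "Eq (App f (rs @ t # ss)) (App f (rs @ t # ts)) \<in> M"
    using Cons.IH[of "rs @ [t]"] Cons.hyps Cons.prems by simp
  ultimately show ?case
    by (rule Eq_trans) (use Cons.hyps Cons.prems wfs in auto)
qed

definition cl :: "tm \<Rightarrow> tm set" where "cl t = {s. wf_tm s \<and> Eq t s \<in> M}"

definition carrier :: "tm set set" where "carrier = cl ` {t. wf_tm t}"

definition interp :: "code \<Rightarrow> tm set list \<Rightarrow> tm set" where
  "interp f ds = cl (App f (map (\<lambda>d. SOME t. t \<in> d) ds))"

lemma cl_eq_iff: "wf_tm s \<Longrightarrow> wf_tm t \<Longrightarrow> cl s = cl t \<longleftrightarrow> Eq s t \<in> M"
  unfolding cl_def using Eq_refl[of t] Eq_sym[of s t] Eq_trans[of s t] Eq_trans[of t s] by blast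

lemma rep_cl: "wf_tm t \<Longrightarrow> wf_tm (SOME s. s \<in> cl t) \<and> Eq t (SOME s. s \<in> cl t) \<in> M"
proof -
  assume "wf_tm t"
  then have "t \<in> cl t" by (simp add: cl_def Eq_refl)
  then have "(SOME s. s \<in> cl t) \<in> cl t" by (rule someI)
  then show ?thesis by (simp add: cl_def)
qed

text \<open>By congruence, the representatives chosen in \<open>interp\<close> do not affect the
  value.\<close>

lemma interp_cl:
  assumes "wf_tm (App f ts)"
  shows "interp f (map cl ts) = cl (App f ts)"
proof -
  let ?us = "map (\<lambda>t. SOME s. s \<in> cl t) ts"
  have "list_all2 (\<lambda>s t. wf_tm s \<and> wf_tm t \<and> Eq s t \<in> M) ts ?us"
    using assms rep_cl by (auto simp: list_all2_conv_all_nth)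
  then have "Eq (App f ts) (App f ?us) \<in> M"
    using Eq_App[of ts ?us "[]" f] assms by simp
  moreover have "wf_tm (App f ?us)" using assms rep_cl by auto
  ultimately have "cl (App f ts) = cl (App f ?us)" using assms cl_eq_iff by blast
  then show ?thesis by (simp add: interp_def comp_def)
qed

lemma struct_carrier:
  assumes "\<And>i. wf_tm (\<sigma> i)"
  shows "struct carrier interp (\<lambda>i. cl (\<sigma> i))"
  unfolding struct_def
proof (intro conjI allI impI)
  show "range (\<lambda>i. cl (\<sigma> i)) \<subseteq> carrier" using assms by (auto simp: carrier_def)
  fix f ds assume f: "elem_code (length ds) f" "set ds \<subseteq> carrier"
  then have "ds \<in> lists carrier" by auto
  then obtain ts where "ds = map cl ts" "\<forall>t\<in>set ts. wf_tm t"
    unfolding carrier_def lists_image by auto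
  with f show "interp f ds \<in> carrier" by (auto simp: interp_cl carrier_def)
qed

lemma eval_interp:
  "wf_tm t \<Longrightarrow> (\<And>i. wf_tm (\<sigma> i)) \<Longrightarrow> eval interp (\<lambda>i. cl (\<sigma> i)) t = cl (subst_tm \<sigma> t)"
proof (induction t)
  case (App f ts)
  then have "map (eval interp (\<lambda>i. cl (\<sigma> i))) ts = map cl (map (subst_tm \<sigma>) ts)" by auto
  moreover have "wf_tm (subst_tm \<sigma> (App f ts))" using App.prems by (rule wf_subst_tm)
  ultimately show ?case by (simp only: eval.simps subst_tm.simps interp_cl)
qed simp

text \<open>Truth lemma. It is proved for all substitutions because, in the quantifier case, each
  element of \<open>carrier\<close> is the class of a term, and that term extends
  \<open>\<sigma>\<close>.\<close>

lemma sat_interp: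
  "wf_fm \<phi> \<Longrightarrow> (\<And>i. wf_tm (\<sigma> i)) \<Longrightarrow> sat carrier interp (\<lambda>i. cl (\<sigma> i)) \<phi> \<longleftrightarrow> subst \<sigma> \<phi> \<in> M"
proof (induction \<phi> arbitrary: \<sigma>)
  case Fls
  then show ?case by (simp add: Fls_notin)
next
  case (Eq s t)
  then show ?case by (simp add: eval_interp cl_eq_iff wf_subst_tm)
next
  case (Imp \<phi> \<psi>)
  then show ?case by (simp add: Imp_iff wf_subst)
next
  case (Forall \<phi>)
  have "sat carrier interp (case_nat (cl t) (\<lambda>i. cl (\<sigma> i))) \<phi> \<longleftrightarrow> inst t (subst (up \<sigma>) \<phi>) \<in> M"
    if "wf_tm t" for t
  proof -
    have "case_nat (cl t) (\<lambda>i. cl (\<sigma> i)) = (\<lambda>i. cl (case_nat t \<sigma> i))"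
      by (auto simp: fun_eq_iff split: nat.split)
    moreover have "wf_tm (case_nat t \<sigma> i)" for i
      using that Forall.prems by (auto split: nat.split)
    ultimately show ?thesis using Forall by (simp add: inst_subst_up)
  qed
  moreover have "wf_fm (subst (up \<sigma>) \<phi>)"
    by (rule wf_subst) (use Forall.prems wf_up in auto)
  ultimately show ?case by (auto simp: Forall_iff carrier_def)
qed

end

lemma model_existence:
  assumes "\<not> X \<tturnstile> Fls"
  obtains D I and e :: "nat \<Rightarrow> tm set"
  where "struct D I e" "\<And>\<phi>. \<phi> \<in> X \<Longrightarrow> wf_fm \<phi> \<Longrightarrow> sat D I e \<phi>"
proof -
  \<comment> \<open>Doubling the indices frees the odd variables for use as Henkin witnesses.\<close>
  let ?X = "subst (\<lambda>i. Var (2 * i)) ` X"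
  have "\<not> ?X \<tturnstile> Fls"
  proof
    assume "?X \<tturnstile> Fls"
    then obtain \<Gamma> where \<Gamma>: "set \<Gamma> \<subseteq> ?X" "derives \<Gamma> Fls" unfolding provable_def by blast
    \<comment> \<open>Halving undoes the doubling, so a refutation of \<open>?X\<close> becomes one
      of \<open>X\<close>.\<close>
    let ?\<sigma> = "\<lambda>i. Var (i div 2)"
    have "derives (map (subst ?\<sigma>) \<Gamma>) (subst ?\<sigma> Fls)" by (rule derives_subst[OF \<Gamma>(2)]) simp
    moreover have "set (map (subst ?\<sigma>) \<Gamma>) \<subseteq> X" using \<Gamma>(1) by (auto simp: subst_comp)
    ultimately show False using assms unfolding provable_def by auto
  qed
  moreover have "infinite (UNIV - \<Union>(fv ` ?X))"
  proof -
    have "range (\<lambda>i. Suc (2 * i)) \<subseteq> UNIV - \<Union>(fv ` ?X)"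
      by (auto simp: fv_subst dest: arg_cong[where f = even])
    moreover have "infinite (range (\<lambda>i::nat. Suc (2 * i)))"
      using finite_imageD[of "\<lambda>i::nat. Suc (2 * i)" UNIV] by (auto simp: inj_on_def)
    ultimately show ?thesis using finite_subset by blast
  qed
  ultimately obtain Y where Y: "?X \<subseteq> Y" "\<not> Y \<tturnstile> Fls"
    "\<And>\<phi>. wf_fm \<phi> \<Longrightarrow> \<exists>v. Imp (inst (Var v) \<phi>) (Forall \<phi>) \<in> Y"
    using henkin_extension[of ?X] by metis
  obtain M where M: "Y \<subseteq> M" "\<not> M \<tturnstile> Fls" "\<And>\<phi>. \<not> insert \<phi> M \<tturnstile> Fls \<Longrightarrow> \<phi> \<in> M"
    using lindenbaum[OF Y(2)] by blast
  interpret max_henkin M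
    by unfold_locales (rule M(2), erule M(3), use M(1) Y(3) in blast)
  show thesis
  proof
    show "struct carrier interp (\<lambda>i. cl (Var (2 * i)))" by (rule struct_carrier) simp
    fix \<phi> assume "\<phi> \<in> X" "wf_fm \<phi>"
    then show "sat carrier interp (\<lambda>i. cl (Var (2 * i))) \<phi>"
      using Y(1) M(1) by (subst sat_interp) auto
  qed
qed

text \<open>Structures over \<open>tm set\<close> suffice because the term model has that type.
  Theorems of EA are obtained semantically from here on.\<close>

theorem completeness:
  assumes "wf_fm \<phi>"
    and "\<And>D I (e :: nat \<Rightarrow> tm set).
      struct D I e \<Longrightarrow> (\<And>\<psi>. \<psi> \<in> X \<Longrightarrow> wf_fm \<psi> \<Longrightarrow> sat D I e \<psi>) \<Longrightarrow> sat D I e \<phi>"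
  shows "X \<tturnstile> \<phi>"
proof (rule provable_RAA[OF _ assms(1)], rule ccontr)
  assume "\<not> insert (Neg \<phi>) X \<tturnstile> Fls"
  then obtain D I and e :: "nat \<Rightarrow> tm set" where M: "struct D I e"
    "\<And>\<psi>. \<psi> \<in> insert (Neg \<phi>) X \<Longrightarrow> wf_fm \<psi> \<Longrightarrow> sat D I e \<psi>"
    using model_existence by blast
  have "sat D I e \<phi>" by (rule assms(2)[OF M(1)]) (use M(2) in blast)
  moreover have "sat D I e (Neg \<phi>)" by (rule M(2)) (use assms(1) in auto)
  ultimately show False by simp
qed

lemma soundness: "X \<tturnstile> \<phi> \<Longrightarrow> struct D I e \<Longrightarrow> (\<And>\<psi>. \<psi> \<in> X \<Longrightarrow> sat D I e \<psi>) \<Longrightarrow> sat D I e \<phi>"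
  unfolding provable_def using derives_sound by blast

section \<open>Quantifier prefixes\<close>

lemma fv_Forall_pow: "fv ((Forall ^^ n) \<phi>) = {k. k + n \<in> fv \<phi>}"
  by (induction n) auto

lemma fv_Exists_pow: "fv (((\<lambda>\<chi>. Exists \<chi>) ^^ n) \<phi>) = {k. k + n \<in> fv \<phi>}"
  by (induction n) auto

lemma wf_Forall_pow: "wf_fm ((Forall ^^ n) \<phi>) = wf_fm \<phi>"
  by (induction n) auto

lemma wf_Exists_pow: "wf_fm (((\<lambda>\<chi>. Exists \<chi>) ^^ n) \<phi>) = wf_fm \<phi>"
  by (induction n) auto

text \<open>The variables bound by the prefix occupy the indices below \<open>n\<close>, so an old
  index \<open>m\<close> reappears as \<open>m + n\<close>.\<close>

lemma sat_Forall_pow: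
  assumes "struct D I e"
  shows "sat D I e ((Forall ^^ n) \<phi>) \<longleftrightarrow>
    (\<forall>e'. struct D I e' \<longrightarrow> (\<forall>m. e' (m + n) = e m) \<longrightarrow> sat D I e' \<phi>)"
  using assms
proof (induction n arbitrary: e)
  case 0
  have "(\<forall>m. e' m = e m) \<longleftrightarrow> e' = e" for e' by auto
  with 0 show ?case by simp
next
  case (Suc n)
  have "(\<forall>m. e' (m + Suc n) = e m) \<longleftrightarrow> (\<forall>m. e' (m + n) = case_nat (e' n) e m)" for e'
  proof
    assume "\<forall>m. e' (m + n) = case_nat (e' n) e m"
    then show "\<forall>m. e' (m + Suc n) = e m" by (metis add_Suc_shift old.nat.simps(5))
  qed (auto split: nat.split)
  moreover have "d = e' n" if "\<forall>m. e' (m + n) = case_nat d e m" for d e'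
    using that[rule_format, of 0] by simp
  ultimately have "(\<forall>d\<in>D. \<forall>e'. struct D I e' \<longrightarrow> (\<forall>m. e' (m + n) = case_nat d e m) \<longrightarrow> sat D I e' \<phi>)
    \<longleftrightarrow> (\<forall>e'. struct D I e' \<longrightarrow> (\<forall>m. e' (m + Suc n) = e m) \<longrightarrow> sat D I e' \<phi>)"
    by (metis struct_env)
  then show ?case using Suc.IH[OF struct_case_nat[OF Suc.prems]] by simp
qed

lemma sat_Exists_pow:
  assumes "struct D I e"
  shows "sat D I e (((\<lambda>\<chi>. Exists \<chi>) ^^ n) \<phi>) \<longleftrightarrow>
    (\<exists>e'. struct D I e' \<and> (\<forall>m. e' (m + n) = e m) \<and> sat D I e' \<phi>)"
proof -
  have "sat D I e (((\<lambda>\<chi>. Exists \<chi>) ^^ n) \<phi>) \<longleftrightarrow> \<not> sat D I e ((Forall ^^ n) (Neg \<phi>))" for e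
    by (induction n arbitrary: e) auto
  then show ?thesis using sat_Forall_pow[OF assms] by auto
qed

lemma sat_closure:
  assumes "struct D I e" "fv \<phi> \<subseteq> {..<n}"
  shows "sat D I e ((Forall ^^ n) \<phi>) \<longleftrightarrow> (\<forall>e'. struct D I e' \<longrightarrow> sat D I e' \<phi>)"
proof
  assume *: "sat D I e ((Forall ^^ n) \<phi>)"
  show "\<forall>e'. struct D I e' \<longrightarrow> sat D I e' \<phi>"
  proof (intro allI impI)
    fix e' assume e': "struct D I e'"
    \<comment> \<open>Below \<open>n\<close>, where all free variables of \<open>\<phi>\<close> lie,
      this copies \<open>e'\<close>; from \<open>n\<close> on it is the shifted \<open>e\<close>
      that the prefix demands.\<close>
    let ?e = "\<lambda>m. if m < n then e' m else e (m - n)"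
    have "struct D I ?e"
      by (rule struct_change[OF e']) (use struct_env[OF assms(1)] struct_env[OF e'] in simp)
    then have "sat D I ?e \<phi>" using * sat_Forall_pow[OF assms(1)] by simp
    moreover have "sat D I ?e \<phi> = sat D I e' \<phi>"
      by (rule sat_cong) (use assms(2) in auto)
    ultimately show "sat D I e' \<phi>" by simp
  qed
qed (simp add: sat_Forall_pow[OF assms(1)])

section \<open>Theories axiomatised by universal-existential sentences\<close>

text \<open>The domain of the substructure generated by the values of \<open>e\<close>.\<close>

definition reduct :: "(code \<Rightarrow> 'a list \<Rightarrow> 'a) \<Rightarrow> (nat \<Rightarrow> 'a) \<Rightarrow> 'a set" where
  "reduct I e = eval I e ` {t. wf_tm t}"

lemma struct_reduct: "struct (reduct I e) I e"
  unfolding struct_def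
proof (intro conjI allI impI)
  show "range e \<subseteq> reduct I e"
    unfolding reduct_def by (auto intro!: image_eqI[of "e _" "eval I e" "Var _"])
  fix f ds assume f: "elem_code (length ds) f" "set ds \<subseteq> reduct I e"
  then have "ds \<in> lists (reduct I e)" by auto
  then obtain ts where ts: "ds = map (eval I e) ts" "\<forall>t\<in>set ts. wf_tm t"
    unfolding reduct_def lists_image by auto
  then show "I f ds \<in> reduct I e"
    unfolding reduct_def using f(1) by (intro image_eqI[of _ _ "App f ts"]) auto
qed

text \<open>\<open>pi2\<close> is a semantic form of \<forall>\<exists>-axiomatisability: validity
  of the theorems \<open>Exists \<theta>\<close>, with their free variables read universally through
  \<open>e'\<close>, forces every axiom. The element type is that of the term models.\<close>

locale pi2_theory =
  fixes T :: "fm set"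
  assumes T_wf: "\<phi> \<in> T \<Longrightarrow> wf_fm \<phi>"
    and T_closed: "\<phi> \<in> T \<Longrightarrow> fv \<phi> = {}"
    and pi2: "\<And>D I (e :: nat \<Rightarrow> tm set). struct D I e \<Longrightarrow>
      (\<And>\<theta> e'. qf \<theta> \<Longrightarrow> T \<tturnstile> Exists \<theta> \<Longrightarrow> struct D I e' \<Longrightarrow> sat D I e' (Exists \<theta>)) \<Longrightarrow>
      \<phi> \<in> T \<Longrightarrow> sat D I e \<phi>"
begin

lemma sat_T_cong: "\<phi> \<in> T \<Longrightarrow> sat D I e \<phi> = sat D I e' \<phi>"
  by (rule sat_cong) (use T_closed in auto)

text \<open>The axioms are sentences, so substituting throughout a derivation leaves its hypotheses
  unchanged.\<close>

lemma provable_subst: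
  assumes "T \<tturnstile> \<phi>" "\<And>i. wf_tm (\<sigma> i)"
  shows "T \<tturnstile> subst \<sigma> \<phi>"
proof -
  obtain \<Gamma> where \<Gamma>: "set \<Gamma> \<subseteq> T" "derives \<Gamma> \<phi>" using assms(1) unfolding provable_def by blast
  have "subst \<sigma> \<psi> = subst Var \<psi>" if "\<psi> \<in> T" for \<psi>
    by (rule subst_cong) (use T_closed[OF that] in auto)
  then have "map (subst \<sigma>) \<Gamma> = \<Gamma>" using \<Gamma>(1) by (auto intro!: map_idI)
  moreover have "derives (map (subst \<sigma>) \<Gamma>) (subst \<sigma> \<phi>)" by (rule derives_subst[OF \<Gamma>(2) assms(2)])
  ultimately show ?thesis using \<Gamma>(1) unfolding provable_def by metis
qed

end

text \<open>\<open>AB\<close> yields the contradiction in the submodel of answers; \<open>BA\<close>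
  shows that requests for a y can be answered once \<exists>z. \<forall>u. B holds.\<close>

locale delta2 = pi2_theory +
  fixes A B :: fm
  assumes A: "wf_fm A" "qf A" "fv A \<subseteq> {0, 1, 2}"
    and B: "wf_fm B" "qf B" "fv B \<subseteq> {0, 1, 2}"
    and AB: "T \<tturnstile> Imp (Forall (Exists A)) (Exists (Forall B))"
    and BA: "T \<tturnstile> Imp (Exists (Forall B)) (Forall (Exists A))"
begin

text \<open>
  A request is a quantifier-free formula whose index 0 stands for the witness that is asked for.
  \<open>req t A\<close> asks for a \<open>y\<close> with \<open>A(t, y, c)\<close>, and \<open>req t (Neg B)\<close> for a counterexample to
  \<open>\<forall>u. B(t, u, c)\<close>.
\<close>

definition req :: "tm \<Rightarrow> fm \<Rightarrow> fm" where
  "req t \<phi> = subst (up (case_nat t Var)) \<phi>"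

definition legit :: "fm \<Rightarrow> bool" where
  "legit \<theta> \<longleftrightarrow> qf \<theta> \<and> wf_fm \<theta> \<and>
     ((\<exists>t. wf_tm t \<and> \<theta> = req t A) \<or> (\<exists>t. wf_tm t \<and> \<theta> = req t (Neg B)) \<or> T \<tturnstile> Exists \<theta>)"

text \<open>
  The requests are enumerated with repetitions; the \<open>j\<close>-th one may mention \<open>c\<close>, which is
  index 0, and the witnesses of earlier requests, which are the indices 1 to \<open>j\<close>.
  Its own witness is the index \<open>Suc j\<close>.
\<close>

definition request :: "nat \<Rightarrow> fm" where
  "request j = (let \<theta> = from_nat (fst (prod_decode j)) in
     if legit \<theta> \<and> fv \<theta> \<subseteq> {..Suc j} then \<theta> else Imp Fls Fls)"

definition answer :: "nat \<Rightarrow> fm" where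
  "answer j = inst (Var (Suc j)) (request j)"

text \<open>This is \<open>E\<^sub>i\<close> of the overview. Under \<open>i\<close> quantifiers c
  has index \<open>i\<close>, so the reversal \<open>i - m\<close> sends c (index 0) there and the
  witnesses 1 to \<open>i\<close> to the bound indices \<open>i - 1\<close> down to 0.\<close>

definition answerable :: "nat \<Rightarrow> fm" where
  "answerable i = ((\<lambda>\<chi>. Exists \<chi>) ^^ i)
     (subst (\<lambda>m. Var (i - m)) (foldr (\<lambda>\<phi> \<psi>. And \<phi> \<psi>) (map answer [0..<i]) (Imp Fls Fls)))"

lemma sat_req:
  "sat D I (case_nat d e) (req t \<phi>) = sat D I (case_nat d (case_nat (eval I e t) e)) \<phi>"
  unfolding req_def sat_subst
  by (rule sat_cong) (auto simp: eval_subst split: nat.split)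

text \<open>The filler formula in \<open>request\<close> has to be a legal request itself; any
  element answers it.\<close>

lemma legit_trivial: "legit (Imp Fls Fls)"
proof -
  have "T \<tturnstile> Exists (Imp Fls Fls)"
    by (rule completeness) (auto dest: struct_env[of _ _ _ 0])
  then show ?thesis by (simp add: legit_def)
qed

lemma legit_request: "legit (request j)"
  using legit_trivial by (simp add: request_def Let_def)

lemma fv_request: "fv (request j) \<subseteq> {..Suc j}"
  by (simp add: request_def Let_def)

lemma fv_answer: "fv (answer j) \<subseteq> {..Suc j}"
  using fv_request[of j] by (auto simp: answer_def inst_def fv_subst split: nat.splits)

lemma legit_wf: "legit \<theta> \<Longrightarrow> wf_fm \<theta>" and legit_qf: "legit \<theta> \<Longrightarrow> qf \<theta>"
  by (simp_all add: legit_def)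

lemma wf_answer: "wf_fm (answer j)"
  using legit_wf[OF legit_request] by (simp add: answer_def wf_inst)

lemma qf_answer: "qf (answer j)"
  using legit_qf[OF legit_request] by (simp add: answer_def inst_def)

lemma sat_answer: "sat D I e (answer j) = sat D I (case_nat (e (Suc j)) e) (request j)"
  by (simp add: answer_def sat_inst)

lemma request_surj:
  assumes "legit \<theta>"
  obtains j where "request j = \<theta>"
proof -
  obtain N where "fv \<theta> \<subseteq> {..N}" using finite_nat_set_iff_bounded_le[of "fv \<theta>"] by auto
  let ?j = "prod_encode (to_nat \<theta>, N)"
  have "N \<le> ?j" by (rule le_prod_encode_2)
  with \<open>fv \<theta> \<subseteq> {..N}\<close> have "fv \<theta> \<subseteq> {..Suc ?j}" by force
  with assms have "request ?j = \<theta>" by (simp add: request_def)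
  then show thesis by (rule that)
qed

lemma wf_answerable: "wf_fm (answerable i)"
proof -
  have "wf_fm (foldr (\<lambda>\<phi> \<psi>. And \<phi> \<psi>) (map answer js) (Imp Fls Fls))" for js
    by (induction js) (auto simp: wf_answer)
  then show ?thesis by (simp add: answerable_def wf_Exists_pow wf_subst)
qed

lemma fv_answerable: "fv (answerable i) \<subseteq> {0}"
  by (auto simp: answerable_def fv_Exists_pow fv_subst)

lemma sigma1_answerable: "sigma1 (answerable i)"
proof -
  have "qf (foldr (\<lambda>\<phi> \<psi>. And \<phi> \<psi>) (map answer js) (Imp Fls Fls))" for js
    by (induction js) (auto simp: qf_answer)
  then show ?thesis unfolding sigma1_def answerable_def by (metis qf_subst)
qed

lemma sat_answerable:
  assumes "struct D I e"
  shows "sat D I e (answerable i) \<longleftrightarrow>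
    (\<exists>e'. struct D I e' \<and> e' 0 = e 0 \<and> (\<forall>j<i. sat D I e' (answer j)))"
proof -
  let ?\<chi> = "foldr (\<lambda>\<phi> \<psi>. And \<phi> \<psi>) (map answer [0..<i]) (Imp Fls Fls)"
  have "sat D I e' (foldr (\<lambda>\<phi> \<psi>. And \<phi> \<psi>) (map answer js) (Imp Fls Fls)) \<longleftrightarrow>
      (\<forall>j\<in>set js. sat D I e' (answer j))" for e' js
    by (induction js) auto
  then have "sat D I e (answerable i) \<longleftrightarrow> (\<exists>e1. struct D I e1 \<and> (\<forall>m. e1 (m + i) = e m) \<and>
      (\<forall>j<i. sat D I (\<lambda>m. e1 (i - m)) (answer j)))"
    unfolding answerable_def sat_Exists_pow[OF assms] sat_subst by (simp add: Ball_def)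
  also have "\<dots> \<longleftrightarrow> (\<exists>e'. struct D I e' \<and> e' 0 = e 0 \<and> (\<forall>j<i. sat D I e' (answer j)))"
  proof
    assume "\<exists>e1. struct D I e1 \<and> (\<forall>m. e1 (m + i) = e m) \<and>
      (\<forall>j<i. sat D I (\<lambda>m. e1 (i - m)) (answer j))"
    then obtain e1 where e1: "struct D I e1" "\<forall>m. e1 (m + i) = e m"
      "\<forall>j<i. sat D I (\<lambda>m. e1 (i - m)) (answer j)" by blast
    then have "e1 i = e 0" by (metis add_0)
    with e1 show "\<exists>e'. struct D I e' \<and> e' 0 = e 0 \<and> (\<forall>j<i. sat D I e' (answer j))"
      by (intro exI[of _ "\<lambda>m. e1 (i - m)"]) (simp add: struct_change[OF e1(1)] struct_env[OF e1(1)])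
  next
    assume "\<exists>e'. struct D I e' \<and> e' 0 = e 0 \<and> (\<forall>j<i. sat D I e' (answer j))"
    then obtain e' where e': "struct D I e'" "e' 0 = e 0" "\<forall>j<i. sat D I e' (answer j)"
      by blast
    \<comment> \<open>The reversal undone: witnesses fill the block below \<open>i\<close>, and the
      shifted \<open>e\<close> follows. At \<open>i\<close> both clauses agree because
      \<open>e' 0 = e 0\<close>.\<close>
    define e1 where "e1 m = (if m \<le> i then e' (i - m) else e (m - i))" for m
    have "struct D I e1"
      by (rule struct_change[OF assms])
        (use struct_env[OF assms] struct_env[OF e'(1)] in \<open>simp add: e1_def\<close>)
    moreover have "\<forall>m. e1 (m + i) = e m" using e'(2) by (simp add: e1_def)
    moreover have "sat D I (\<lambda>m. e1 (i - m)) (answer j) = sat D I e' (answer j)" if "j < i" for j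
      by (rule sat_cong) (use fv_answer[of j] that in \<open>auto simp: e1_def\<close>)
    ultimately show "\<exists>e1. struct D I e1 \<and> (\<forall>m. e1 (m + i) = e m) \<and>
      (\<forall>j<i. sat D I (\<lambda>m. e1 (i - m)) (answer j))"
      using e'(3) by auto
  qed
  finally show ?thesis .
qed

section \<open>The requests cannot all be answered\<close>

lemma inconsistent: "T \<union> range answer \<tturnstile> Fls"
proof (rule ccontr)
  assume "\<not> ?thesis"
  then obtain D I and e :: "nat \<Rightarrow> tm set" where M: "struct D I e"
    "\<And>\<phi>. \<phi> \<in> T \<union> range answer \<Longrightarrow> wf_fm \<phi> \<Longrightarrow> sat D I e \<phi>"
    using model_existence by blast
  let ?D = "reduct I e"
  \<comment> \<open>The witness is the value of the variable \<open>Suc j\<close>, hence lies in the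
    submodel.\<close>
  have answered: "\<exists>d\<in>?D. sat ?D I (case_nat d e) \<theta>" if legit: "legit \<theta>" for \<theta>
  proof -
    obtain j where "request j = \<theta>" using request_surj[OF legit] .
    then have "sat D I (case_nat (e (Suc j)) e) \<theta>"
      using M(2)[of "answer j"] by (simp add: wf_answer sat_answer)
    then have "sat ?D I (case_nat (e (Suc j)) e) \<theta>"
      using sat_qf[OF legit_qf[OF legit]] by blast
    then show ?thesis using struct_env[OF struct_reduct] by blast
  qed
  have "sat ?D I e' (Exists \<theta>)" if \<theta>: "qf \<theta>" "T \<tturnstile> Exists \<theta>" and e': "struct ?D I e'" for \<theta> e'
  proof -
    have "\<exists>t. wf_tm t \<and> e' i = eval I e t" for i
      using struct_env[OF e'] unfolding reduct_def by blast
    \<comment> \<open>Elements of the submodel are values of terms; substituting these terms into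
      the theorem \<open>Exists \<theta>\<close> gives another theorem, hence a legal
      request.\<close>
    then obtain \<tau> where \<tau>: "\<And>i. wf_tm (\<tau> i)" "\<And>i. e' i = eval I e (\<tau> i)" by metis
    have "T \<tturnstile> Exists (subst (up \<tau>) \<theta>)" using provable_subst[OF \<theta>(2) \<tau>(1)] by simp
    moreover from this have "wf_fm (Exists (subst (up \<tau>) \<theta>))"
      unfolding provable_def by (blast dest: derives_wf)
    ultimately have "legit (subst (up \<tau>) \<theta>)" using \<theta>(1) by (simp add: legit_def)
    then obtain d where d: "d \<in> ?D" "sat ?D I (case_nat d e) (subst (up \<tau>) \<theta>)"
      using answered by blast
    have "(\<lambda>i. eval I (case_nat d e) (up \<tau> i)) = case_nat d e'"
      by (auto simp: fun_eq_iff eval_subst \<tau>(2) split: nat.split)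
    with d show ?thesis by (auto simp: sat_subst)
  qed
  then have T: "sat ?D I e \<phi>" if "\<phi> \<in> T" for \<phi>
    by (rule pi2[OF struct_reduct _ that])
  have "\<exists>d\<in>?D. sat ?D I (case_nat d (case_nat x e)) A" if "x \<in> ?D" for x
  proof -
    obtain t where t: "wf_tm t" "x = eval I e t" using \<open>x \<in> ?D\<close> unfolding reduct_def by blast
    then have "wf_tm (up (case_nat t Var) i)" for i by (intro wf_up) (simp split: nat.split)
    then have "legit (req t A)" using A t(1) by (auto simp: legit_def req_def wf_subst)
    then show ?thesis using answered[of "req t A"] t(2) by (simp add: sat_req)
  qed
  then have "sat ?D I e (Forall (Exists A))" by auto
  then have "sat ?D I e (Exists (Forall B))"
    using soundness[OF AB struct_reduct T] by simp
  then obtain z where z: "z \<in> ?D" "\<forall>u\<in>?D. sat ?D I (case_nat u (case_nat z e)) B" by auto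
  then obtain t where t: "wf_tm t" "z = eval I e t" unfolding reduct_def by blast
  then have "wf_tm (up (case_nat t Var) i)" for i by (intro wf_up) (simp split: nat.split)
  then have "legit (req t (Neg B))" using B t(1) by (auto simp: legit_def req_def wf_subst)
  then show False using answered[of "req t (Neg B)"] t(2) z(2) by (auto simp: sat_req)
qed

lemma not_answerable:
  obtains k where
    "\<And>D I (e :: nat \<Rightarrow> tm set). struct D I e \<Longrightarrow> (\<And>\<phi>. \<phi> \<in> T \<Longrightarrow> sat D I e \<phi>) \<Longrightarrow>
      \<not> sat D I e (answerable k)"
proof -
  obtain \<Gamma> where \<Gamma>: "set \<Gamma> \<subseteq> T \<union> range answer" "derives \<Gamma> Fls"
    using inconsistent unfolding provable_def by blast
  \<comment> \<open>Compactness: the refutation mentions finitely many answers, and \<open>k\<close>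
    exceeds their indices.\<close>
  have "finite (set \<Gamma> - T)" "set \<Gamma> - T \<subseteq> range answer" using \<Gamma>(1) by auto
  then obtain J where J: "finite J" "set \<Gamma> - T = answer ` J" by (meson finite_subset_image)
  then obtain k where k: "J \<subseteq> {..<k}" using finite_nat_set_iff_bounded[of J] by auto
  show thesis
  proof
    fix D I and e :: "nat \<Rightarrow> tm set"
    assume M: "struct D I e" "\<And>\<phi>. \<phi> \<in> T \<Longrightarrow> sat D I e \<phi>"
    show "\<not> sat D I e (answerable k)"
    proof
      assume "sat D I e (answerable k)"
      then obtain e' where e': "struct D I e'" "\<forall>j<k. sat D I e' (answer j)"
        using sat_answerable[OF M(1)] by blast
      have "sat D I e' \<phi>" if "\<phi> \<in> set \<Gamma>" for \<phi>
      proof (cases "\<phi> \<in> T")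
        case True
        then show ?thesis using M(2)[OF True] sat_T_cong[OF True, of D I e e'] by simp
      next
        case False
        with that have "\<phi> \<in> answer ` J" using J(2) by blast
        with k e'(2) show ?thesis by auto
      qed
      then have "sat D I e' Fls" by (rule derives_sound[OF \<Gamma>(2) e'(1)])
      then show False by simp
    qed
  qed
qed

text \<open>Otherwise storing \<open>d\<close> at index \<open>Suc i\<close> would answer one more
  request, as the earlier answers use only smaller indices.\<close>

lemma answers_extend:
  assumes "struct D I e" "\<not> sat D I e (answerable (Suc i))"
    and "struct D I e'" "e' 0 = e 0" "\<forall>j<i. sat D I e' (answer j)" and "d \<in> D"
  shows "\<not> sat D I (case_nat d e') (request i)"
proof
  assume *: "sat D I (case_nat d e') (request i)"
  let ?e = "e'(Suc i := d)"
  have "struct D I ?e"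
    by (rule struct_change[OF assms(3)]) (use struct_env[OF assms(3)] assms(6) in simp)
  moreover have "sat D I ?e (answer j)" if "j < Suc i" for j
  proof (cases "j = i")
    case True
    \<comment> \<open>Index 0 of the request reads \<open>d\<close>, so its other indices reach only
      positions up to \<open>i\<close> and miss the update.\<close>
    have "sat D I (case_nat d ?e) (request i) = sat D I (case_nat d e') (request i)"
      by (rule sat_cong) (use fv_request[of i] in \<open>auto split: nat.split\<close>)
    with * True show ?thesis by (simp add: sat_answer)
  next
    case False
    have "sat D I ?e (answer j) = sat D I e' (answer j)"
      by (rule sat_cong) (use fv_answer[of j] False that in auto)
    with False that assms(5) show ?thesis by simp
  qed
  ultimately have "sat D I e (answerable (Suc i))"
    unfolding sat_answerable[OF assms(1)] using assms(4) by (intro exI[of _ ?e]) auto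
  with assms(2) show False ..
qed

text \<open>An assignment of answers shares only c with \<open>e\<close>, and c is all that
  \<open>A\<close> and \<open>B\<close> see of it beyond their two quantified variables.\<close>

lemma sat_parameter:
  assumes "fv \<phi> \<subseteq> {0, 1, 2}" "e' 0 = e 0"
  shows "sat D I (case_nat y (case_nat x e')) \<phi> = sat D I (case_nat y (case_nat x e)) \<phi>"
  by (rule sat_cong) (use assms in \<open>auto split: nat.split simp: numeral_2_eq_2\<close>)

theorem delta2_bool_comb_sigma1:
  "\<exists>\<psi>. wf_fm \<psi> \<and> fv \<psi> \<subseteq> {0} \<and> bool_comb sigma1 \<psi> \<and> T \<tturnstile> Iff (Exists (Forall B)) \<psi>"
proof -
  obtain k where k: "\<And>D I (e :: nat \<Rightarrow> tm set). struct D I e \<Longrightarrow>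
    (\<And>\<phi>. \<phi> \<in> T \<Longrightarrow> sat D I e \<phi>) \<Longrightarrow> \<not> sat D I e (answerable k)"
    using not_answerable by blast
  define steps where "steps = filter (\<lambda>i. \<exists>t. wf_tm t \<and> request i = req t (Neg B)) [0..<k]"
  define exact where "exact i = And (answerable i) (Neg (answerable (Suc i)))" for i
  define disj where "disj js = foldr (\<lambda>\<phi> \<psi>. Or \<phi> \<psi>) (map exact js) Fls" for js
  have sat_disj: "sat D I e (disj js) \<longleftrightarrow> (\<exists>i\<in>set js. sat D I e (exact i))" for D I js
    and e :: "nat \<Rightarrow> tm set"
    by (induction js) (auto simp: disj_def)
  have "wf_fm (disj js)" for js
    by (induction js) (auto simp: disj_def exact_def wf_answerable)
  moreover have "fv (disj js) \<subseteq> {0}" for js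
    using fv_answerable by (induction js) (auto simp: disj_def exact_def)
  moreover have "bool_comb sigma1 (disj js)" for js
  proof (induction js)
    case Nil
    have "sigma1 Fls" unfolding sigma1_def by (intro exI[of _ 0] exI[of _ Fls]) simp
    then show ?case by (simp add: disj_def bool_comb.intros(1))
  next
    case (Cons i js)
    have "bool_comb sigma1 (exact i)"
      unfolding exact_def by (intro bool_comb.intros sigma1_answerable)
    with Cons show ?case unfolding disj_def by (simp add: bool_comb.intros(4))
  qed
  moreover have "T \<tturnstile> Iff (Exists (Forall B)) (disj steps)"
  proof (rule completeness)
    show "wf_fm (Iff (Exists (Forall B)) (disj steps))" using \<open>\<And>js. wf_fm (disj js)\<close> B by simp
    fix D I and e :: "nat \<Rightarrow> tm set"
    assume M: "struct D I e" "\<And>\<phi>. \<phi> \<in> T \<Longrightarrow> wf_fm \<phi> \<Longrightarrow> sat D I e \<phi>"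
    then have T: "sat D I e' \<phi>" if "\<phi> \<in> T" for \<phi> e'
      using M(2)[OF that T_wf[OF that]] sat_T_cong[OF that, of D I e e'] by simp
    have "sat D I e (disj steps)" if Ex: "sat D I e (Exists (Forall B))"
    proof -
      \<comment> \<open>\<open>answerable 0\<close> always holds and \<open>answerable k\<close>
        fails, so truth is lost at some step.\<close>
      have "\<exists>i<k. sat D I e (answerable i) \<and> \<not> sat D I e (answerable (Suc i))"
      proof (rule ccontr)
        assume *: "\<not> ?thesis"
        have "i \<le> k \<Longrightarrow> sat D I e (answerable i)" for i
        proof (induction i)
          case 0
          then show ?case using M(1) sat_answerable[OF M(1), of 0] by auto
        next
          case (Suc i)
          with * show ?case by simp
        qed
        then show False using k[OF M(1) T] by blast
      qed
      then obtain i where i: "i < k" "sat D I e (answerable i)" "\<not> sat D I e (answerable (Suc i))"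
        by blast
      then obtain e' where e': "struct D I e'" "e' 0 = e 0" "\<forall>j<i. sat D I e' (answer j)"
        using sat_answerable[OF M(1)] by blast
      note none = answers_extend[OF M(1) i(3) e']
      \<comment> \<open>Request \<open>i\<close> has no answer here, but \<open>BA\<close> would
        answer a request for a y, and a theorem answers itself; so only a request for a u
        survives.\<close>
      consider t where "wf_tm t" "request i = req t A"
        | t where "wf_tm t" "request i = req t (Neg B)" | "T \<tturnstile> Exists (request i)"
        using legit_request[of i] unfolding legit_def by blast
      then show ?thesis
      proof cases
        case (1 t)
        have "sat D I e (Forall (Exists A))" using soundness[OF BA M(1) T] Ex by simp
        then obtain y where "y \<in> D" "sat D I (case_nat y (case_nat (eval I e' t) e)) A"
          using eval_in[OF e'(1) 1(1)] by auto
        then show ?thesis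
          using none 1 sat_parameter[where e' = e' and e = e, OF A(3) e'(2)] by (simp add: sat_req)
      next
        case (2 t)
        then have "i \<in> set steps" using i(1) by (auto simp: steps_def)
        then show ?thesis using i by (auto simp: sat_disj exact_def)
      next
        case 3
        then have "sat D I e' (Exists (request i))" using soundness[OF _ e'(1) T] by blast
        then show ?thesis using none by auto
      qed
    qed
    moreover have "sat D I e (Exists (Forall B))" if disj: "sat D I e (disj steps)"
    proof -
      obtain i where "i \<in> set steps" and exact: "sat D I e (exact i)"
        using disj unfolding sat_disj by blast
      then obtain t where i: "wf_tm t" "request i = req t (Neg B)"
        unfolding steps_def by auto
      from exact have exact: "sat D I e (answerable i)" "\<not> sat D I e (answerable (Suc i))"
        unfolding exact_def by simp_all
      then obtain e' where e': "struct D I e'" "e' 0 = e 0" "\<forall>j<i. sat D I e' (answer j)"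
        using sat_answerable[OF M(1)] by blast
      \<comment> \<open>No u is a counterexample, so the value of \<open>t\<close> under
        \<open>e'\<close> is the required z.\<close>
      have "\<forall>u\<in>D. sat D I (case_nat u (case_nat (eval I e' t) e)) B"
        using answers_extend[OF M(1) exact(2) e'] i(2)
          sat_parameter[where e' = e' and e = e, OF B(3) e'(2)] by (simp add: sat_req)
      then show ?thesis using eval_in[OF e'(1) i(1)] by auto
    qed
    ultimately show "sat D I e (Iff (Exists (Forall B)) (disj steps))" by auto
  qed
  ultimately show ?thesis by blast
qed

end

section \<open>The axioms of EA\<close>

lemma elem_code_basic:
  "elem_code (Suc 0) Succ" "elem_code (Suc (Suc 0)) Add" "elem_code (Suc (Suc 0)) Mul"
  "elem_code (Suc (Suc 0)) Monus"
  using elem_code.intros(2,4,5,6) by (simp_all add: numeral_2_eq_2)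

inductive_cases elem_code_CompE: "elem_code n (Comp m f gs)"

lemma wf_def_axiom: "\<chi> \<in> EA_def_axioms \<Longrightarrow> wf_fm \<chi>"
  by (induction rule: EA_def_axioms.induct)
    (auto intro: elem_code.intros elem_code_basic elim: elem_code_CompE simp: Suc_le_eq)

lemma qf_def_axiom: "\<chi> \<in> EA_def_axioms \<Longrightarrow> qf \<chi>"
  by (induction rule: EA_def_axioms.induct) auto

lemma wf_ind_axiom: "wf_fm \<phi> \<Longrightarrow> wf_fm (ind_axiom \<phi>)"
  unfolding ind_axiom_def
  by (auto intro!: wf_inst wf_subst elem_code.intros(1) elem_code_basic split: nat.split)

lemma sat_ind_axiom:
  "sat D I e (ind_axiom \<phi>) \<longleftrightarrow>
    (sat D I (case_nat (I Zero []) e) \<phi> \<and>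
     (\<forall>d\<in>D. sat D I (case_nat d e) \<phi> \<longrightarrow> sat D I (case_nat (I Succ [d]) e) \<phi>) \<longrightarrow>
     (\<forall>d\<in>D. sat D I (case_nat d e) \<phi>))"
proof -
  have "sat D I (case_nat d e) (subst (case_nat (succ_tm (Var 0)) (\<lambda>i. Var (Suc i))) \<phi>) =
      sat D I (case_nat (I Succ [d]) e) \<phi>" for d
    unfolding sat_subst by (rule sat_cong) (auto split: nat.split)
  then show ?thesis by (auto simp: ind_axiom_def sat_inst)
qed

text \<open>
  In the environment \<open>w, a, e\<close> this says that \<open>w\<close> is a place below \<open>a\<close> where induction for \<open>\<phi>\<close>
  breaks down; prefixed by \<open>\<exists>w\<close> it is a universal-existential form of the induction axiom.
\<close>

definition ind_request :: "fm \<Rightarrow> fm" where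
  "ind_request \<phi> = (let at = (\<lambda>t. subst (case_nat t (\<lambda>i. Var (Suc (Suc i)))) \<phi>) in
     Imp (And (at zero_tm) (Neg (at (Var 1))))
         (And (at (Var 0)) (Neg (at (succ_tm (Var 0))))))"

lemma sat_ind_request:
  "sat D I (case_nat w (case_nat a e)) (ind_request \<phi>) \<longleftrightarrow>
    (sat D I (case_nat (I Zero []) e) \<phi> \<and> \<not> sat D I (case_nat a e) \<phi> \<longrightarrow>
     sat D I (case_nat w e) \<phi> \<and> \<not> sat D I (case_nat (I Succ [w]) e) \<phi>)"
proof -
  have "sat D I (case_nat w (case_nat a e)) (subst (case_nat t (\<lambda>i. Var (Suc (Suc i)))) \<phi>) =
      sat D I (case_nat (eval I (case_nat w (case_nat a e)) t) e) \<phi>" for t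
    unfolding sat_subst by (rule sat_cong) (auto split: nat.split)
  then show ?thesis by (simp add: ind_request_def)
qed

lemma wf_ind_request: "wf_fm \<phi> \<Longrightarrow> wf_fm (ind_request \<phi>)"
  unfolding ind_request_def Let_def
  by (auto intro!: wf_subst elem_code.intros(1) elem_code_basic split: nat.split)

lemma qf_ind_request: "qf \<phi> \<Longrightarrow> qf (ind_request \<phi>)"
  by (simp add: ind_request_def)

lemma EA_E:
  assumes "\<psi> \<in> EA"
  obtains n \<chi> where "\<psi> = (Forall ^^ n) \<chi>" "fv \<chi> \<subseteq> {..<n}" "wf_fm \<chi>" "\<chi> \<in> EA_def_axioms"
  | n \<phi> where "\<psi> = (Forall ^^ n) (ind_axiom \<phi>)" "fv (ind_axiom \<phi>) \<subseteq> {..<n}" "wf_fm \<phi>" "qf \<phi>"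
  using assms wf_def_axiom unfolding EA_def by blast

lemma EA_sat:
  assumes "(Forall ^^ n) \<chi> \<in> EA" "fv \<chi> \<subseteq> {..<n}" "wf_fm \<chi>"
    and "struct D I e" "\<And>\<psi>. \<psi> \<in> EA \<Longrightarrow> wf_fm \<psi> \<Longrightarrow> sat D I e \<psi>" "struct D I e'"
  shows "sat D I e' \<chi>"
  using sat_closure[OF assms(4,2)] assms by (simp add: wf_Forall_pow)

interpretation EA: pi2_theory EA
proof
  fix \<psi> assume "\<psi> \<in> EA"
  then show "wf_fm \<psi>" by (elim EA_E) (auto simp: wf_Forall_pow wf_ind_axiom)
  from \<open>\<psi> \<in> EA\<close> show "fv \<psi> = {}" by (elim EA_E) (auto simp: fv_Forall_pow)
next
  fix D I \<psi> and e :: "nat \<Rightarrow> tm set"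
  assume S: "struct D I e"
    and pi2: "\<And>\<theta> e'. qf \<theta> \<Longrightarrow> EA \<tturnstile> Exists \<theta> \<Longrightarrow> struct D I e' \<Longrightarrow> sat D I e' (Exists \<theta>)"
    and "\<psi> \<in> EA"
  from \<open>\<psi> \<in> EA\<close> show "sat D I e \<psi>"
  proof (cases rule: EA_E)
    case (1 n \<chi>)
    \<comment> \<open>A vacuous existential quantifier brings the quantifier-free axiom into the
      form that \<open>pi2\<close> covers.\<close>
    have "EA \<tturnstile> Exists (lift \<chi>)"
    proof (rule completeness)
      show "wf_fm (Exists (lift \<chi>))" using 1(3) by (simp add: lift_def wf_subst)
      fix D I and e :: "nat \<Rightarrow> tm set"
      assume M: "struct D I e" "\<And>\<psi>. \<psi> \<in> EA \<Longrightarrow> wf_fm \<psi> \<Longrightarrow> sat D I e \<psi>"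
      have "sat D I e \<chi>"
        using EA_sat[OF _ 1(2,3) M M(1)] \<open>\<psi> \<in> EA\<close> 1(1) by simp
      then show "sat D I e (Exists (lift \<chi>))"
        using struct_env[OF M(1)] by (auto simp: sat_lift)
    qed
    moreover have "qf (lift \<chi>)" using qf_def_axiom[OF 1(4)] by (simp add: lift_def)
    ultimately have "sat D I e' \<chi>" if "struct D I e'" for e'
      using pi2[OF _ _ that, of "lift \<chi>"] by (auto simp: sat_lift)
    then show ?thesis using sat_closure[OF S 1(2)] 1(1) by simp
  next
    case (2 n \<phi>)
    have "EA \<tturnstile> Exists (ind_request \<phi>)"
    proof (rule completeness)
      show "wf_fm (Exists (ind_request \<phi>))" using 2(3) by (simp add: wf_ind_request)
      fix D I and e :: "nat \<Rightarrow> tm set"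
      assume M: "struct D I e" "\<And>\<psi>. \<psi> \<in> EA \<Longrightarrow> wf_fm \<psi> \<Longrightarrow> sat D I e \<psi>"
      \<comment> \<open>Index 0 is the point a at which induction is tested; the remaining indices
        are the parameters of \<open>\<phi>\<close>.\<close>
      have e: "e = case_nat (e 0) (\<lambda>i. e (Suc i))" by (auto simp: fun_eq_iff split: nat.split)
      have "struct D I (\<lambda>i. e (Suc i))" by (rule struct_change[OF M(1)]) (rule struct_env[OF M(1)])
      then have "sat D I (\<lambda>i. e (Suc i)) (ind_axiom \<phi>)"
        using EA_sat[OF _ 2(2) wf_ind_axiom[OF 2(3)] M] \<open>\<psi> \<in> EA\<close> 2(1) by simp
      then have "\<exists>w\<in>D. sat D I (case_nat w (case_nat (e 0) (\<lambda>i. e (Suc i)))) (ind_request \<phi>)"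
        using struct_env[OF M(1)] unfolding sat_ind_axiom sat_ind_request by blast
      then show "sat D I e (Exists (ind_request \<phi>))" using e by simp
    qed
    then have request: "\<exists>w\<in>D. sat D I (case_nat w e') (ind_request \<phi>)" if "struct D I e'" for e'
      using pi2[OF qf_ind_request[OF 2(4)] _ that] by simp
    \<comment> \<open>If a refutes the conclusion of induction while \<open>\<phi>\<close> holds at
      zero, the witness \<open>w\<close> refutes the induction step.\<close>
    have "sat D I e' (ind_axiom \<phi>)" if "struct D I e'" for e'
      using request[OF struct_case_nat[OF that]] unfolding sat_ind_axiom sat_ind_request by blast
    then show ?thesis using sat_closure[OF S 2(2)] 2(1) by simp
  qed
qed

(* In A the variables y, x, c are the indices 0, 1, 2; in B the variables u, z, c are the
   indices 0, 1, 2.  Outside the two quantifiers, and in psi, c is index 0. *)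
theorem theorem3p3:
  fixes A B :: fm
  assumes "wf_fm A" and "qf A" and "fv A \<subseteq> {0, 1, 2}"
    and "wf_fm B" and "qf B" and "fv B \<subseteq> {0, 1, 2}"
    and "EA \<tturnstile> Iff (Forall (Exists A)) (Exists (Forall B))"
  shows "\<exists>\<psi>. wf_fm \<psi> \<and> fv \<psi> \<subseteq> {0} \<and> bool_comb sigma1 \<psi> \<and>
    EA \<tturnstile> Iff (Exists (Forall B)) \<psi>"
proof -
  have Iff: "sat D I e (Forall (Exists A)) = sat D I e (Exists (Forall B))"
    if "struct D I e" "\<And>\<psi>. \<psi> \<in> EA \<Longrightarrow> wf_fm \<psi> \<Longrightarrow> sat D I e \<psi>" for D I and e :: "nat \<Rightarrow> tm set"
    using soundness[OF assms(7) that(1)] that(2) EA.T_wf by auto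
  have "EA \<tturnstile> Imp (Forall (Exists A)) (Exists (Forall B))"
    by (rule completeness) (use assms Iff in auto)
  moreover have "EA \<tturnstile> Imp (Exists (Forall B)) (Forall (Exists A))"
    by (rule completeness) (use assms Iff in auto)
  ultimately interpret delta2 EA A B
    using assms by unfold_locales
  show ?thesis by (rule delta2_bool_comb_sigma1)
qed

end
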